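(* Let $\epsilon'>0$ with $\epsilon'=O(\epsilon)$. For the single-machine algorithms $\mathcal{A}$ and $\mathcal{B}$ described in the context, the total fractional weighted flow-time of $\mathcal{A}$, and hence the total (integral) weighted flow-time of the jobs not rejected by $\mathcal{B}$, is $O(F^{\mathcal{O}^{\epsilon'}}/\epsilon^2)$.
   Context: Single machine; a finite set of jobs arrives online; job $j$ has integer release time $r_j$, integer processing time $p_j>0$ and weight $w_j>0$; its density is $\rho_j=w_j/p_j$. The parameter $\epsilon$ satisfies $\epsilon^2\le 1/2$ and $1/\epsilon\in\mathbb{Z}$. For $x>0$, $\lfloor x\rfloor_2$ denotes the largest integer $i$ with $2^i\le x$; $\lfloor\rho_j\rfloor_2$ is the density class of $j$. Algorithm $\mathcal{A}$ (which may reject and preempt) works in unit time slots. A job is active at time $t$ if it has been released by $t$, has not finished by $t$ and has not been rejected; $A(t)$ is the active set. $p_j(t)$ is the remaining processing time of $j$ at time $t$ and $w_j(t)=\rho_j p_j(t)$. A set $L$ of "preemptible" jobs is maintained; once a job enters $L$ it stays there until it finishes. At each integer time $t$: (1) each job arriving at $t$ (jobs arriving simultaneously are considered one at a time in a fixed arbitrary order, steps (1)-(2) being done for each) is either immediately rejected by the rule below or added to the active set; (2) if the job $j$ processed in slot $[t-1,t]$ is not in $L$, let $t'$ be the time $\mathcal{A}$ started processing $j$ (so $j$ was processed uninterruptedly during $[t',t]$); if the total weight of jobs arriving during $(t',t]$ exceeds $w_j/\epsilon$, then $j$ is added to $L$; (3) if the job processed in $[t-1,t]$ has not finished and is not in $L$,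 it is processed in $[t,t+1]$; otherwise $\mathcal{A}$ processes in $[t,t+1]$ an active job of highest density. Immediate rejection rule. For an arriving job $j$, $A(r_j)$ denotes the jobs active at time $r_j$, excluding $j$ and excluding jobs arriving at $r_j$ that are considered after $j$. Let $D_j^+=\{j'\in A(r_j):\lfloor\rho_{j'}\rfloor_2\ge\lfloor\rho_j\rfloor_2\}$, $D_j^-=A(r_j)\setminus D_j^+$, $\alpha_j^+=w_j\sum_{j'\in D_j^+,\rho_{j'}\ge\rho_j}p_{j'}(r_j)+p_j\sum_{j'\in D_j^+,\rho_{j'}<\rho_j}w_{j'}(r_j)$, $\alpha_j^-=p_j\sum_{j'\in D_j^-}w_{j'}(r_j)$. Table $T^+$: if $\alpha_j^+\ge w_jp_j/\epsilon$, $j$ is assigned to the bucket $(\lfloor\alpha_j^+/w_j\rfloor_2,\lfloor w_j\rfloor_2)$ of $T^+$; in each bucket of $T^+$, the first job assigned to it is rejected, and then every $(1/\epsilon)$-th subsequent job. Table $T^-$: if $\alpha_j^->w_jp_j/\epsilon$, $j$ is assigned to the bucket $(\lfloor\alpha_j^-\rfloor_2,\lfloor\rho_j\rfloor_2,\lfloor p_j\rfloor_2)$ of $T^-$; in each bucket of $T^-$, every $(1/\epsilon)$-th job assigned to it is rejected (the first rejected one being the $(1/\epsilon)$-th). Algorithm $\mathcal{B}$ is identical to $\mathcal{A}$ except that whenever $\mathcal{A}$ processes a job of $L$ in a slot, $\mathcal{B}$ leaves the slot idle; thus $\mathcal{B}$ rejects every job that enters $L$ (at the moment it enters $L$), as well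 as the immediately rejected jobs, and processes every other job non-preemptively exactly as $\mathcal{A}$ does. The weighted flow-time of a job completed at $C_j$ is $w_j(C_j-r_j)$. For any schedule, the fractional weighted flow-time is $\sum_j\sum_{t\ge r_j}w_j(t)$ with $w_j(t)$ being $\rho_j$ times the remaining processing time of $j$ at time $t$ in that schedule. $\mathcal{O}^{\epsilon'}$ denotes an optimal offline schedule processing all jobs (preemption allowed, no rejections) on a machine of speed $1+\epsilon'$, and $F^{\mathcal{O}^{\epsilon'}}$ its fractional weighted flow-time. Constants in $O(\cdot)$ are absolute. *)

theory Defs
  imports "HOL-Analysis.Analysis"
begin

text \<open>
  Time starts at 0. Jobs are named by natural numbers; jobs arriving at the same time are
  considered in the order of their names. As names are arbitrary, this allows any fixed order.
\<close>

record flow_instance =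
  jobs :: "nat set"
  release :: "nat \<Rightarrow> nat"
  ptime :: "nat \<Rightarrow> nat"
  weight :: "nat \<Rightarrow> real"

definition valid_instance :: "flow_instance \<Rightarrow> bool" where
  "valid_instance I \<longleftrightarrow>
     finite (jobs I) \<and> (\<forall>j\<in>jobs I. 0 < ptime I j \<and> 0 < weight I j)"

definition density :: "flow_instance \<Rightarrow> nat \<Rightarrow> real" where
  "density I j = weight I j / real (ptime I j)"

definition before :: "flow_instance \<Rightarrow> nat \<Rightarrow> nat \<Rightarrow> bool" where
  "before I i j \<longleftrightarrow>
     release I i < release I j \<or> (release I i = release I j \<and> i < j)"

definition floor2 :: "real \<Rightarrow> int" where
  "floor2 x = (GREATEST i. 2 powi i \<le> x)"

lemma floor2_eq_floor_log: "floor2 x = \<lfloor>log 2 x\<rfloor>" if "0 < x"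
  unfolding floor2_def
proof (rule Greatest_equality)
  have iff: "2 powi i \<le> x \<longleftrightarrow> i \<le> \<lfloor>log 2 x\<rfloor>" for i :: int
    using that by (simp add: powr_real_of_int' [symmetric] le_log_iff le_floor_iff)
  show "2 powi \<lfloor>log 2 x\<rfloor> \<le> x"
    by (simp add: iff)
  show "y \<le> \<lfloor>log 2 x\<rfloor>" if "2 powi y \<le> x" for y :: int
    using that by (simp add: iff)
qed

text \<open>
  A unit-slot schedule \<open>S\<close> maps \<open>t\<close> to the job processed in the slot \<open>[t, t + 1]\<close>, if any.
  Throughout, \<open>R\<close> is the set of immediately rejected jobs.
\<close>

definition remaining :: "flow_instance \<Rightarrow> (nat \<Rightarrow> nat option) \<Rightarrow> nat \<Rightarrow> nat \<Rightarrow> real" where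
  "remaining I S j t = real (ptime I j) - real (card {s. s < t \<and> S s = Some j})"

definition remaining_weight ::
    "flow_instance \<Rightarrow> (nat \<Rightarrow> nat option) \<Rightarrow> nat \<Rightarrow> nat \<Rightarrow> real" where
  "remaining_weight I S j t = density I j * remaining I S j t"

definition active :: "flow_instance \<Rightarrow> (nat \<Rightarrow> nat option) \<Rightarrow> nat set \<Rightarrow> nat \<Rightarrow> nat set" where
  "active I S R t = {i \<in> jobs I. release I i \<le> t \<and> 0 < remaining I S i t \<and> i \<notin> R}"

definition active_at_arrival ::
    "flow_instance \<Rightarrow> (nat \<Rightarrow> nat option) \<Rightarrow> nat set \<Rightarrow> nat \<Rightarrow> nat set" where
  "active_at_arrival I S R j = {i \<in> active I S R (release I j). before I i j}"

definition D_plus :: "flow_instance \<Rightarrow> (nat \<Rightarrow> nat option) \<Rightarrow> nat set \<Rightarrow> nat \<Rightarrow> nat set" where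
  "D_plus I S R j =
     {i \<in> active_at_arrival I S R j. floor2 (density I i) \<ge> floor2 (density I j)}"

definition D_minus :: "flow_instance \<Rightarrow> (nat \<Rightarrow> nat option) \<Rightarrow> nat set \<Rightarrow> nat \<Rightarrow> nat set" where
  "D_minus I S R j = active_at_arrival I S R j - D_plus I S R j"

definition alpha_plus :: "flow_instance \<Rightarrow> (nat \<Rightarrow> nat option) \<Rightarrow> nat set \<Rightarrow> nat \<Rightarrow> real" where
  "alpha_plus I S R j =
     weight I j *
       (\<Sum>i | i \<in> D_plus I S R j \<and> density I i \<ge> density I j. remaining I S i (release I j)) +
     real (ptime I j) *
       (\<Sum>i | i \<in> D_plus I S R j \<and> density I i < density I j.
          remaining_weight I S i (release I j))"

definition alpha_minus :: "flow_instance \<Rightarrow> (nat \<Rightarrow> nat option) \<Rightarrow> nat set \<Rightarrow> nat \<Rightarrow> real" where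
  "alpha_minus I S R j =
     real (ptime I j) * (\<Sum>i\<in>D_minus I S R j. remaining_weight I S i (release I j))"

definition assigned_plus ::
    "flow_instance \<Rightarrow> real \<Rightarrow> (nat \<Rightarrow> nat option) \<Rightarrow> nat set \<Rightarrow> nat \<Rightarrow> bool" where
  "assigned_plus I \<epsilon> S R j \<longleftrightarrow>
     alpha_plus I S R j \<ge> weight I j * real (ptime I j) / \<epsilon>"

definition bucket_plus ::
    "flow_instance \<Rightarrow> (nat \<Rightarrow> nat option) \<Rightarrow> nat set \<Rightarrow> nat \<Rightarrow> int \<times> int" where
  "bucket_plus I S R j = (floor2 (alpha_plus I S R j / weight I j), floor2 (weight I j))"

definition assigned_minus ::
    "flow_instance \<Rightarrow> real \<Rightarrow> (nat \<Rightarrow> nat option) \<Rightarrow> nat set \<Rightarrow> nat \<Rightarrow> bool" where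
  "assigned_minus I \<epsilon> S R j \<longleftrightarrow>
     alpha_minus I S R j > weight I j * real (ptime I j) / \<epsilon>"

definition bucket_minus ::
    "flow_instance \<Rightarrow> (nat \<Rightarrow> nat option) \<Rightarrow> nat set \<Rightarrow> nat \<Rightarrow> int \<times> int \<times> int" where
  "bucket_minus I S R j =
     (floor2 (alpha_minus I S R j), floor2 (density I j), floor2 (real (ptime I j)))"

text \<open>
  The number of jobs assigned to the bucket of \<open>j\<close> before \<open>j\<close>. In \<open>T\<^sup>+\<close> the rejected positions
  are \<open>1, 1 + N, 1 + 2N, \<dots>\<close> and in \<open>T\<^sup>-\<close> they are \<open>N, 2N, \<dots>\<close>, where \<open>N = 1 / \<epsilon>\<close>.
  A job may be assigned to both tables, and then advances both counts, whichever rejects it.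
\<close>

definition earlier_plus ::
    "flow_instance \<Rightarrow> real \<Rightarrow> (nat \<Rightarrow> nat option) \<Rightarrow> nat set \<Rightarrow> nat \<Rightarrow> nat" where
  "earlier_plus I \<epsilon> S R j =
     card {i \<in> jobs I. before I i j \<and> assigned_plus I \<epsilon> S R i \<and>
       bucket_plus I S R i = bucket_plus I S R j}"

definition earlier_minus ::
    "flow_instance \<Rightarrow> real \<Rightarrow> (nat \<Rightarrow> nat option) \<Rightarrow> nat set \<Rightarrow> nat \<Rightarrow> nat" where
  "earlier_minus I \<epsilon> S R j =
     card {i \<in> jobs I. before I i j \<and> assigned_minus I \<epsilon> S R i \<and>
       bucket_minus I S R i = bucket_minus I S R j}"

definition rejects_plus ::
    "flow_instance \<Rightarrow> real \<Rightarrow> (nat \<Rightarrow> nat option) \<Rightarrow> nat set \<Rightarrow> nat \<Rightarrow> bool" where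
  "rejects_plus I \<epsilon> S R j \<longleftrightarrow>
     assigned_plus I \<epsilon> S R j \<and> earlier_plus I \<epsilon> S R j mod nat \<lfloor>1 / \<epsilon>\<rfloor> = 0"

definition rejects_minus ::
    "flow_instance \<Rightarrow> real \<Rightarrow> (nat \<Rightarrow> nat option) \<Rightarrow> nat set \<Rightarrow> nat \<Rightarrow> bool" where
  "rejects_minus I \<epsilon> S R j \<longleftrightarrow>
     assigned_minus I \<epsilon> S R j \<and> Suc (earlier_minus I \<epsilon> S R j) mod nat \<lfloor>1 / \<epsilon>\<rfloor> = 0"

definition start_time :: "(nat \<Rightarrow> nat option) \<Rightarrow> nat \<Rightarrow> nat" where
  "start_time S j = (LEAST s. S s = Some j)"

text \<open>
  \<open>in_L I \<epsilon> S j t\<close>: job \<open>j\<close> has entered \<open>L\<close> by time \<open>t\<close>, after the arrivals at \<open>t\<close>.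
  A job outside \<open>L\<close> is never interrupted, so its first start is the time \<open>t'\<close> of the
  algorithm. The weight arriving in \<open>(t', t]\<close> only grows while the arrivals at \<open>t\<close> are
  considered one by one, so testing it after the last of them is the same as testing it after
  each. All arrivals count towards it, including rejected ones. A job finishing at \<open>t\<close> does not
  enter \<open>L\<close> at \<open>t\<close>; finished jobs are not removed, as \<open>L\<close> is only consulted for unfinished ones.
\<close>

definition in_L :: "flow_instance \<Rightarrow> real \<Rightarrow> (nat \<Rightarrow> nat option) \<Rightarrow> nat \<Rightarrow> nat \<Rightarrow> bool" where
  "in_L I \<epsilon> S j t \<longleftrightarrow>
     (\<exists>u<t. S u = Some j \<and> 0 < remaining I S j (Suc u) \<and>
        (\<Sum>i | i \<in> jobs I \<and> start_time S j < release I i \<and> release I i \<le> Suc u. weight I i)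
          > weight I j / \<epsilon>)"

definition must_continue ::
    "flow_instance \<Rightarrow> real \<Rightarrow> (nat \<Rightarrow> nat option) \<Rightarrow> nat \<Rightarrow> nat \<Rightarrow> bool" where
  "must_continue I \<epsilon> S j t \<longleftrightarrow>
     0 < t \<and> S (t - 1) = Some j \<and> 0 < remaining I S j t \<and> \<not> in_L I \<epsilon> S j t"

text \<open>
  \<open>A_run I \<epsilon> S R\<close>: on input \<open>I\<close>, algorithm \<open>\<A>\<close> can produce the schedule \<open>S\<close> and the
  immediately rejected jobs \<open>R\<close>. The conditions are causal: the rejection of \<open>j\<close> depends
  only on the slots before its release and the jobs considered before it, and \<open>S t\<close> depends only
  on earlier slots and on the jobs released by \<open>t\<close>. So they are a recursive
  description of the run, whose only freedom is how ties for the highest density are broken.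
\<close>

definition A_run ::
    "flow_instance \<Rightarrow> real \<Rightarrow> (nat \<Rightarrow> nat option) \<Rightarrow> nat set \<Rightarrow> bool" where
  "A_run I \<epsilon> S R \<longleftrightarrow>
     R = {j \<in> jobs I. rejects_plus I \<epsilon> S R j \<or> rejects_minus I \<epsilon> S R j} \<and>
     (\<forall>t. if \<exists>j. must_continue I \<epsilon> S j t then S t = S (t - 1)
          else if active I S R t = {} then S t = None
          else \<exists>j \<in> active I S R t. S t = Some j \<and>
                 (\<forall>i \<in> active I S R t. density I i \<le> density I j))"

definition frac_flow_time ::
    "flow_instance \<Rightarrow> nat set \<Rightarrow> (nat \<Rightarrow> nat \<Rightarrow> real) \<Rightarrow> ennreal" where
  "frac_flow_time I X rem =
     (\<Sum>j\<in>X. \<Sum>k. ennreal (density I j * rem j (release I j + k)))"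

definition A_frac_flow_time ::
    "flow_instance \<Rightarrow> (nat \<Rightarrow> nat option) \<Rightarrow> nat set \<Rightarrow> ennreal" where
  "A_frac_flow_time I S R = frac_flow_time I (jobs I - R) (remaining I S)"

definition B_schedule ::
    "flow_instance \<Rightarrow> real \<Rightarrow> (nat \<Rightarrow> nat option) \<Rightarrow> nat \<Rightarrow> nat option" where
  "B_schedule I \<epsilon> S t =
     (case S t of None \<Rightarrow> None | Some j \<Rightarrow> if in_L I \<epsilon> S j t then None else Some j)"

definition B_rejected ::
    "flow_instance \<Rightarrow> real \<Rightarrow> (nat \<Rightarrow> nat option) \<Rightarrow> nat set \<Rightarrow> nat set" where
  "B_rejected I \<epsilon> S R = R \<union> {j. \<exists>t. in_L I \<epsilon> S j t}"

definition completion_time :: "flow_instance \<Rightarrow> (nat \<Rightarrow> nat option) \<Rightarrow> nat \<Rightarrow> nat" where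
  "completion_time I S j = (LEAST t. remaining I S j t = 0)"

definition B_flow_time ::
    "flow_instance \<Rightarrow> real \<Rightarrow> (nat \<Rightarrow> nat option) \<Rightarrow> nat set \<Rightarrow> real" where
  "B_flow_time I \<epsilon> S R =
     (\<Sum>j\<in>jobs I - B_rejected I \<epsilon> S R.
        weight I j *
          (real (completion_time I (B_schedule I \<epsilon> S) j) - real (release I j)))"

text \<open>
  Offline schedules are not tied to unit slots: \<open>\<sigma> u\<close> is the job processed at the real time
  \<open>u\<close>, if any. Their fractional flow-time, too, is summed over integer times.
\<close>

definition offline_remaining ::
    "flow_instance \<Rightarrow> real \<Rightarrow> (real \<Rightarrow> nat option) \<Rightarrow> nat \<Rightarrow> real \<Rightarrow> real" where
  "offline_remaining I speed \<sigma> j t =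
     real (ptime I j) -
       speed * measure lebesgue {u. real (release I j) \<le> u \<and> u \<le> t \<and> \<sigma> u = Some j}"

definition offline_schedule :: "flow_instance \<Rightarrow> real \<Rightarrow> (real \<Rightarrow> nat option) \<Rightarrow> bool" where
  "offline_schedule I speed \<sigma> \<longleftrightarrow>
     (\<forall>u j. \<sigma> u = Some j \<longrightarrow> j \<in> jobs I \<and> real (release I j) \<le> u) \<and>
     (\<forall>j\<in>jobs I. {u. \<sigma> u = Some j} \<in> sets lebesgue \<and>
        (\<forall>t. 0 \<le> offline_remaining I speed \<sigma> j t) \<and>
        (\<exists>t. offline_remaining I speed \<sigma> j t = 0))"

definition offline_frac_flow_time ::
    "flow_instance \<Rightarrow> real \<Rightarrow> (real \<Rightarrow> nat option) \<Rightarrow> ennreal" where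
  "offline_frac_flow_time I speed \<sigma> =
     frac_flow_time I (jobs I) (\<lambda>j t. offline_remaining I speed \<sigma> j (real t))"

definition opt_frac_flow_time :: "flow_instance \<Rightarrow> real \<Rightarrow> ennreal" where
  "opt_frac_flow_time I speed =
     (INF \<sigma> \<in> {\<sigma>. offline_schedule I speed \<sigma>}. offline_frac_flow_time I speed \<sigma>)"

end

theory Submission
  imports Defs
begin

text \<open>
  The proof is a dual fitting. Let \<open>\<beta> t\<close> be the weight pending in \<open>\<A>\<close> at time \<open>t\<close>, and let
  \<open>\<alpha> j = \<alpha>\<^sup>+ j + \<alpha>\<^sup>- j = p\<^sub>j * (\<Sum>i. p\<^sub>i(r\<^sub>j) * min \<rho>\<^sub>i \<rho>\<^sub>j)\<close>, summed over the jobs \<open>i\<close> active when \<open>j\<close>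
  arrives. As \<open>\<A>\<close> works at unit rate, \<open>\<alpha> j / p\<^sub>j \<le> \<rho>\<^sub>j * (t + 1 - r\<^sub>j) + \<beta> t\<close>, that is, \<open>(\<alpha>, \<beta>)\<close> is
  feasible for the dual of the fractional flow-time problem, so the sum of \<open>\<alpha> j\<close> over all jobs,
  rejected ones included, is at most the offline cost plus \<open>1 + \<epsilon>'\<close> times the flow-time \<open>F\<close> of \<open>\<A>\<close>.
  The sum of \<open>\<alpha> j\<close> over the accepted jobs is at least \<open>F\<close>, up to \<open>O(1 / \<epsilon>)\<close> times
  the sum of \<open>w\<^sub>j * p\<^sub>j\<close>, which pays for the work done on jobs that are not the densest.
  Hence the rejected jobs carry little \<open>\<alpha>\<close>; but by the bucketing they carry an
  \<open>\<Omega>(\<epsilon>)\<close> fraction of all of it, which bounds \<open>F\<close>.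

  The bucketing leaves fewer than \<open>1 / \<epsilon>\<close> jobs per bucket of \<open>T\<^sup>-\<close> unaccounted for. By geometric
  sums, their \<open>\<alpha>\<^sup>-\<close> amounts to at most \<open>O(\<Sum>k. 2\<^sup>k * V\<^sub>k\<^sup>2)\<close>, where \<open>V\<^sub>k\<close> is the largest volume of pending jobs
  of density class at least \<open>k\<close>. For each \<open>k\<close>, looking back from the time when \<open>V\<^sub>k\<close> is attained,
  either the volume stays above \<open>V\<^sub>k / 2\<close> for \<open>D * V\<^sub>k\<close> time units, so that \<open>F\<close> is much larger than \<open>2\<^sup>k * V\<^sub>k\<^sup>2\<close>;
  or \<open>\<A>\<close> was held up by a job of a lower class; or the jobs arrived so fast that the
  offline schedule, too, has a volume of \<open>\<Omega>(V\<^sub>k)\<close> left, as it is at most \<open>\<epsilon>' * D * V\<^sub>k\<close> ahead.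
\<close>

section \<open>Arithmetic preliminaries\<close>

lemma floor2_le: "2 powi floor2 x \<le> x" if "0 < x"
proof -
  have "2 powr real_of_int (floor2 x) \<le> x"
    using that by (simp add: floor2_eq_floor_log le_log_iff [symmetric])
  then show ?thesis by (simp add: powr_real_of_int')
qed

lemma less_floor2: "x < 2 * 2 powi floor2 x" if "0 < x"
proof -
  have "log 2 x < real_of_int (floor2 x) + 1"
    using that by (simp add: floor2_eq_floor_log)
  then have "x < 2 powr (real_of_int (floor2 x) + 1)"
    using that by (simp add: log_less_iff)
  also have "\<dots> = 2 * 2 powi floor2 x"
    by (simp add: powr_add powr_real_of_int')
  finally show ?thesis .
qed

lemma floor2_mono: "floor2 x \<le> floor2 y" if "0 < x" "x \<le> y"
  using that by (simp add: floor2_eq_floor_log floor_mono)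

section \<open>Geometric sums over powers of two\<close>

text \<open>The largest term dominates: all other powers are at most half of it, so by induction
  they add up to at most that term.\<close>

lemma sum_powi_le:
  fixes A :: "int set" and c :: real
  assumes "finite A" and "\<And>i. i \<in> A \<Longrightarrow> 2 powi i \<le> c" and "0 \<le> c"
  shows "(\<Sum>i\<in>A. 2 powi i) \<le> 2 * c"
  using assms
proof (induction A arbitrary: c rule: finite_linorder_max_induct)
  case empty
  then show ?case by simp
next
  case (insert b A)
  have "2 powi i \<le> (2 powi b / 2 :: real)" if "i \<in> A" for i
  proof -
    have "i \<le> b - 1" using insert.hyps(2) that by fastforce
    then have "2 powi i \<le> (2 powi (b - 1) :: real)"
      by (intro power_int_increasing) auto
    then show ?thesis by (simp add: power_int_diff)
  qed
  then have "(\<Sum>i\<in>A. 2 powi i) \<le> 2 * (2 powi b / 2 :: real)"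
    by (intro insert.IH) auto
  moreover have "2 powi b \<le> c" using insert.prems by simp
  ultimately show ?case
    using insert.hyps by (subst sum.insert) auto
qed

text \<open>A Hardy-type inequality: as the weights grow geometrically, replacing the terms by
  prefix sums costs only a constant factor. It lets the weight of all classes below \<open>k\<close>
  be paid for by one squared volume per class.\<close>

lemma sum_square_prefix_le:
  fixes K :: "int set" and x :: "int \<Rightarrow> real"
  assumes "finite K"
  shows "(\<Sum>k\<in>K. (\<Sum>i | i \<in> K \<and> i < k. 2 powi i * x i)\<^sup>2 / 2 powi k)
    \<le> 6 * (\<Sum>k\<in>K. 2 powi k * (x k)\<^sup>2)"
proof -
  \<comment> \<open>the last term on the left at least halves with each class, which the induction exploits\<close>
  have "(\<Sum>k\<in>K. (\<Sum>i | i \<in> K \<and> i < k. 2 powi i * x i)\<^sup>2 / 2 powi k)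
      + 4 * (\<Sum>k\<in>K. 2 powi k * x k)\<^sup>2 / 2 powi b
    \<le> 6 * (\<Sum>k\<in>K. 2 powi k * (x k)\<^sup>2)" if "\<forall>k\<in>K. k < b" for b
    using assms that
  proof (induction K arbitrary: b rule: finite_linorder_max_induct)
    case empty
    then show ?case by simp
  next
    case (insert m K)
    define a where "a = (\<Sum>k\<in>K. 2 powi k * x k)"
    have [simp]: "m \<notin> K" using insert.hyps(2) by blast
    have eq: "{i. (i = m \<or> i \<in> K) \<and> i < k} = {i. i \<in> K \<and> i < k}" if "k \<in> K" for k
      using insert.hyps(2) that by force
    have eqm: "{i. (i = m \<or> i \<in> K) \<and> i < m} = K"
      using insert.hyps(2) by force
    have IH: "(\<Sum>k\<in>K. (\<Sum>i | i \<in> K \<and> i < k. 2 powi i * x i)\<^sup>2 / 2 powi k)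
        + 4 * a\<^sup>2 / 2 powi m \<le> 6 * (\<Sum>k\<in>K. 2 powi k * (x k)\<^sup>2)"
      unfolding a_def using insert.IH insert.hyps(2) by blast
    have "m + 1 \<le> b" using insert.prems by simp
    then have "2 powi (m + 1) \<le> (2 powi b :: real)"
      by (intro power_int_increasing) auto
    then have "2 * 2 powi m \<le> (2 powi b :: real)"
      by (simp add: power_int_add)
    then have "4 * (2 powi m * x m + a)\<^sup>2 / 2 powi b \<le> 4 * (2 powi m * x m + a)\<^sup>2 / (2 * 2 powi m)"
      by (intro divide_left_mono) auto
    also have "\<dots> = 2 * (2 powi m * x m + a)\<^sup>2 / 2 powi m" by simp
    also have "\<dots> \<le> (6 * (2 powi m * x m)\<^sup>2 + 3 * a\<^sup>2) / 2 powi m"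
    proof (intro divide_right_mono)
      \<comment> \<open>The split into 6 and 3 is chosen so that 3 here and 1 from the new prefix
        term of \<open>m\<close> make up exactly the factor 4 of \<open>a\<close> in the induction
        hypothesis.\<close>
      have "0 \<le> (2 * (2 powi m * x m) - a)\<^sup>2" by simp
      then show "2 * (2 powi m * x m + a)\<^sup>2 \<le> 6 * (2 powi m * x m)\<^sup>2 + 3 * a\<^sup>2"
        by (simp add: power2_eq_square algebra_simps)
    qed simp
    also have "\<dots> = 6 * (2 powi m * (x m)\<^sup>2) + 3 * a\<^sup>2 / 2 powi m"
      by (simp add: add_divide_distrib power2_eq_square)
    finally have "4 * (2 powi m * x m + a)\<^sup>2 / 2 powi b
        \<le> 6 * (2 powi m * (x m)\<^sup>2) + 3 * a\<^sup>2 / 2 powi m" .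
    with IH show ?case
      using insert.hyps(1)
      by (simp add: eq eqm a_def [symmetric] cong: sum.cong)
  qed
  from this [of "Max K + 1"]
  have "(\<Sum>k\<in>K. (\<Sum>i | i \<in> K \<and> i < k. 2 powi i * x i)\<^sup>2 / 2 powi k)
      + 4 * (\<Sum>k\<in>K. 2 powi k * x k)\<^sup>2 / 2 powi (Max K + 1)
    \<le> 6 * (\<Sum>k\<in>K. 2 powi k * (x k)\<^sup>2)"
    using assms by (simp add: le_imp_less_Suc zle_add1_eq_le)
  moreover have "0 \<le> 4 * (\<Sum>k\<in>K. 2 powi k * x k)\<^sup>2 / 2 powi (Max K + 1)"
    by simp
  ultimately show ?thesis by linarith
qed

text \<open>Two nested geometric sums, over \<open>i\<close> for fixed \<open>l\<close> and then
  over \<open>l\<close>. It is applied to the buckets of one density class, with \<open>i\<close>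
  the class of \<alpha> and \<open>l\<close> that of the processing time.\<close>

lemma sum_powi_pairs_le:
  fixes B :: "(int \<times> int) set" and c d :: real
  assumes "finite B" and "\<And>i l. (i, l) \<in> B \<Longrightarrow> 2 powi i \<le> c * 2 powi l"
    and "\<And>i l. (i, l) \<in> B \<Longrightarrow> 2 powi l \<le> d" and "0 \<le> c" and "0 \<le> d"
  shows "(\<Sum>b\<in>B. 2 powi fst b) \<le> 4 * c * d"
proof -
  have "(\<Sum>b\<in>B. 2 powi fst b) = (\<Sum>l\<in>snd ` B. \<Sum>b | b \<in> B \<and> snd b = l. 2 powi fst b :: real)"
    using assms(1) by (rule sum.image_gen)
  also have "\<dots> \<le> (\<Sum>l\<in>snd ` B. 2 * c * 2 powi l)"
  proof (intro sum_mono)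
    fix l
    have "(\<Sum>b | b \<in> B \<and> snd b = l. 2 powi fst b :: real)
        = (\<Sum>i\<in>fst ` {b. b \<in> B \<and> snd b = l}. 2 powi i)"
      by (subst sum.reindex) (auto simp: inj_on_def)
    also have "\<dots> \<le> 2 * (c * 2 powi l)"
    proof (intro sum_powi_le)
      show "2 powi i \<le> c * 2 powi l" if "i \<in> fst ` {b. b \<in> B \<and> snd b = l}" for i
        using that assms(2)[of i l] by auto
    qed (use assms(1,4) in auto)
    finally show "(\<Sum>b | b \<in> B \<and> snd b = l. 2 powi fst b) \<le> 2 * c * 2 powi l" by simp
  qed
  also have "\<dots> = 2 * c * (\<Sum>l\<in>snd ` B. 2 powi l)" by (simp add: sum_distrib_left)
  also have "\<dots> \<le> 2 * c * (2 * d)"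
  proof (intro mult_left_mono sum_powi_le)
    show "2 powi l \<le> d" if "l \<in> snd ` B" for l
      using that assms(3) by auto
  qed (use assms(1,4,5) in auto)
  finally show ?thesis by simp
qed

section \<open>Sums over time\<close>

text \<open>A quantity that drops by at most 2 per step stays above a triangle of height
  \<open>f a\<close> and base \<open>f a / 2\<close>. The rate 2 is the largest offline speed
  considered.\<close>

lemma square_le_sum_of_slow_decrease:
  fixes f :: "nat \<Rightarrow> real"
  assumes "\<And>t. 0 \<le> f t" and "\<And>t. f t - 2 \<le> f (Suc t)" and "a \<le> b" and "f b = 0"
  shows "(f a)\<^sup>2 \<le> 4 * (\<Sum>t=a..<b. f t)"
proof -
  have step: "(f t)\<^sup>2 - (f (Suc t))\<^sup>2 \<le> 4 * f t" for t
  proof (cases "f t \<le> 2")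
    case True
    then have "f t * f t \<le> 2 * f t" by (intro mult_right_mono assms)
    then show ?thesis using assms(1)[of t] zero_le_power2[of "f (Suc t)"]
      unfolding power2_eq_square by linarith
  next
    case False
    then have "(f t - 2)\<^sup>2 \<le> (f (Suc t))\<^sup>2"
      by (intro power_mono assms) auto
    then show ?thesis by (simp add: power2_eq_square algebra_simps)
  qed
  have "(f a)\<^sup>2 - (f b)\<^sup>2 = (\<Sum>t=a..<b. (f t)\<^sup>2 - (f (Suc t))\<^sup>2)"
    using sum_Suc_diff'[OF \<open>a \<le> b\<close>, of "\<lambda>t. - (f t)\<^sup>2"] by simp
  also have "\<dots> \<le> (\<Sum>t=a..<b. 4 * f t)"
    by (intro sum_mono step)
  finally show ?thesis using assms(4) by (simp add: sum_distrib_left)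
qed

text \<open>With \<open>f\<close> the remaining offline time of a job, this turns processed work
  weighted by the age of the job into fractional flow-time.\<close>

lemma sum_by_parts_linear:
  fixes f :: "nat \<Rightarrow> real"
  assumes "a \<le> b"
  shows "(\<Sum>t=a..<b. (real t + 1 - real a) * (f t - f (Suc t)))
    = (\<Sum>t=a..<b. f t) - (real b - real a) * f b"
  using assms by (induction b rule: dec_induct) (simp_all add: algebra_simps)

section \<open>Counting the rejected positions of a bucket\<close>

text \<open>Every position lies in a block of length \<open>N\<close> that begins with a rejected
  position, so even an incomplete last block contains a rejection.\<close>

lemma card_multiples_ge:
  fixes N n :: nat
  assumes "0 < N"
  shows "n \<le> N * card {m. m < n \<and> m mod N = 0}"
proof -
  let ?C = "{m. m < n \<and> m mod N = 0}"
  have "{..<n} \<subseteq> (\<Union>q\<in>?C. {q..<q + N})"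
  proof
    fix m assume "m \<in> {..<n}"
    then have "m div N * N < n"
      by (metis div_times_less_eq_dividend le_less_trans lessThan_iff)
    then have "m div N * N \<in> ?C" by simp
    moreover have "m \<in> {m div N * N..<m div N * N + N}"
      using assms by (simp add: dividend_less_div_times add.commute)
    ultimately show "m \<in> (\<Union>q\<in>?C. {q..<q + N})" by (rule UN_I)
  qed
  then have "card {..<n} \<le> card (\<Union>q\<in>?C. {q..<q + N})"
    by (intro card_mono) auto
  also have "\<dots> \<le> (\<Sum>q\<in>?C. card {q..<q + N})"
    by (intro card_UN_le) auto
  finally show ?thesis by (simp add: mult.commute)
qed

text \<open>Here a rejected position ends its block, so an incomplete last block contains none; this
  is the additive \<open>N\<close>.\<close>

lemma card_Suc_multiples_ge:
  fixes N n :: nat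
  assumes "0 < N"
  shows "n \<le> N * card {m. m < n \<and> Suc m mod N = 0} + N"
proof -
  let ?C = "{m. m < n \<and> Suc m mod N = 0}"
  have "{..<n} \<subseteq> (\<Union>q\<in>?C. {Suc q - N..<Suc q}) \<union> {n - N..<n}"
  proof
    fix m assume "m \<in> {..<n}"
    define q where "q = m div N * N + (N - 1)"
    have Suc_q: "Suc q = (m div N + 1) * N" using assms by (simp add: q_def)
    have "m < Suc q" unfolding Suc_q using assms
      by (simp add: dividend_less_div_times add.commute)
    moreover have "Suc q - N \<le> m" unfolding Suc_q by simp
    moreover have "Suc q mod N = 0" unfolding Suc_q by simp
    ultimately show "m \<in> (\<Union>q\<in>?C. {Suc q - N..<Suc q}) \<union> {n - N..<n}"
      using \<open>m \<in> {..<n}\<close> by (cases "q < n") (auto intro!: bexI[of _ q])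
  qed
  then have "card {..<n} \<le> card ((\<Union>q\<in>?C. {Suc q - N..<Suc q}) \<union> {n - N..<n})"
    by (intro card_mono) auto
  also have "\<dots> \<le> card (\<Union>q\<in>?C. {Suc q - N..<Suc q}) + card {n - N..<n}"
    by (rule card_Un_le)
  also have "\<dots> \<le> (\<Sum>q\<in>?C. card {Suc q - N..<Suc q}) + N"
    by (intro add_mono card_UN_le) auto
  also have "\<dots> \<le> (\<Sum>q\<in>?C. N) + N"
    by (intro add_mono sum_mono) auto
  finally show ?thesis by (simp add: mult.commute)
qed

text \<open>On a set of jobs \<open>before\<close> is a strict linear order, so counting
  predecessors numbers the jobs from 0 without gaps.\<close>

lemma bij_betw_rank:
  fixes J :: "nat set"
  assumes "finite J"
  shows "bij_betw (\<lambda>j. card {i \<in> J. before I i j}) J {..<card J}"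
proof -
  let ?rank = "\<lambda>j. card {i \<in> J. before I i j}"
  have less: "?rank i < ?rank j" if "i \<in> J" "j \<in> J" "before I i j" for i j
    using that assms by (intro psubset_card_mono) (auto simp: before_def)
  have "inj_on ?rank J"
  proof (rule inj_onI)
    fix i j assume "i \<in> J" "j \<in> J" "?rank i = ?rank j"
    then have "\<not> before I i j" "\<not> before I j i" using less by fastforce+
    then show "i = j" unfolding before_def by linarith
  qed
  moreover have "?rank ` J \<subseteq> {..<card J}"
    using assms by (auto intro!: psubset_card_mono simp: before_def)
  ultimately show ?thesis
    by (simp add: bij_betw_def card_image card_subset_eq)
qed

lemma card_rank_filter:
  assumes "finite J"
  shows "card {j \<in> J. Q (card {i \<in> J. before I i j})} = card {m. m < card J \<and> Q m}"
proof (rule bij_betw_same_card)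
  show "bij_betw (\<lambda>j. card {i \<in> J. before I i j})
      {j \<in> J. Q (card {i \<in> J. before I i j})} {m. m < card J \<and> Q m}"
    using bij_betw_rank[OF assms, of I] unfolding bij_betw_def inj_on_def by auto
qed

text \<open>All values in a bucket agree up to the factor \<open>C\<close>, so counting suffices: at
  least one job in \<open>N\<close> is rejected.\<close>

lemma sum_le_sum_rank_multiples:
  fixes f :: "nat \<Rightarrow> real"
  assumes "finite J" and "0 < N" and "\<And>j. j \<in> J \<Longrightarrow> c \<le> f j \<and> f j \<le> C * c" and "0 \<le> C * c" "0 \<le> C"
  shows "(\<Sum>j\<in>J. f j) \<le> C * real N * (\<Sum>j | j \<in> J \<and> card {i \<in> J. before I i j} mod N = 0. f j)"
proof -
  let ?Rej = "{j \<in> J. card {i \<in> J. before I i j} mod N = 0}"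
  have "card J \<le> N * card ?Rej"
    using card_multiples_ge[OF assms(2), of "card J"]
    by (simp add: card_rank_filter[OF assms(1), of "\<lambda>m. m mod N = 0"])
  then have card: "real (card J) \<le> real N * real (card ?Rej)"
    unfolding of_nat_mult [symmetric] by (rule of_nat_mono)
  have "(\<Sum>j\<in>J. f j) \<le> real (card J) * (C * c)"
    using assms(3) by (intro sum_bounded_above) auto
  also have "\<dots> \<le> real N * real (card ?Rej) * (C * c)"
    using card assms(4) by (rule mult_right_mono)
  also have "\<dots> = C * real N * (real (card ?Rej) * c)" by simp
  also have "\<dots> \<le> C * real N * (\<Sum>j\<in>?Rej. f j)"
    using assms(3,5) by (intro mult_left_mono sum_bounded_below) auto
  finally show ?thesis .
qed

text \<open>The extra term pays for the incomplete last block: at most \<open>N\<close> jobs of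
  value at most \<open>C * c\<close>.\<close>

lemma sum_le_sum_Suc_rank_multiples:
  fixes f :: "nat \<Rightarrow> real"
  assumes "finite J" and "0 < N" and "\<And>j. j \<in> J \<Longrightarrow> c \<le> f j \<and> f j \<le> C * c" and "0 \<le> C * c" "0 \<le> C"
  shows "(\<Sum>j\<in>J. f j) \<le> C * real N * (\<Sum>j | j \<in> J \<and> Suc (card {i \<in> J. before I i j}) mod N = 0. f j)
    + C * real N * c"
proof -
  let ?Rej = "{j \<in> J. Suc (card {i \<in> J. before I i j}) mod N = 0}"
  have "card J \<le> N * card ?Rej + N"
    using card_Suc_multiples_ge[OF assms(2), of "card J"]
    by (simp add: card_rank_filter[OF assms(1), of "\<lambda>m. Suc m mod N = 0"])
  then have card: "real (card J) \<le> real N * real (card ?Rej) + real N"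
    unfolding of_nat_mult [symmetric] of_nat_add [symmetric] by (rule of_nat_mono)
  have "(\<Sum>j\<in>J. f j) \<le> real (card J) * (C * c)"
    using assms(3) by (intro sum_bounded_above) auto
  also have "\<dots> \<le> (real N * real (card ?Rej) + real N) * (C * c)"
    using card assms(4) by (rule mult_right_mono)
  also have "\<dots> = C * real N * (real (card ?Rej) * c) + C * real N * c"
    by (simp add: algebra_simps)
  also have "\<dots> \<le> C * real N * (\<Sum>j\<in>?Rej. f j) + C * real N * c"
    using assms(3,5) by (intro add_right_mono mult_left_mono sum_bounded_below) auto
  finally show ?thesis .
qed

text \<open>Used to charge the mutual delay of two jobs to the arrival of the later one.\<close>

lemma sum_pairs_eq:
  fixes h :: "nat \<Rightarrow> nat \<Rightarrow> real"
  assumes "finite A"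
  shows "(\<Sum>j\<in>A. \<Sum>i\<in>A. h j i)
    = (\<Sum>j\<in>A. h j j) + (\<Sum>j\<in>A. \<Sum>i | i \<in> A \<and> before I i j. h j i + h i j)"
proof -
  let ?g = "\<lambda>j i. if before I i j then h j i else 0"
  let ?g' = "\<lambda>j i. if before I j i then h j i else 0"
  have split: "(\<Sum>i\<in>A. h j i) = h j j + (\<Sum>i\<in>A. ?g j i) + (\<Sum>i\<in>A. ?g' j i)" if "j \<in> A" for j
  proof -
    have "(\<Sum>i\<in>A. h j i) = (\<Sum>i\<in>A. (if i = j then h j i else 0) + ?g j i + ?g' j i)"
      by (intro sum.cong) (auto simp: before_def)
    then show ?thesis using that assms by (simp add: sum.distrib sum.delta)
  qed
  have "(\<Sum>j\<in>A. \<Sum>i\<in>A. ?g' j i) = (\<Sum>j\<in>A. \<Sum>i\<in>A. if before I i j then h i j else 0)"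
    by (rule sum.swap)
  then have eq: "(\<Sum>j\<in>A. \<Sum>i\<in>A. h j i) = (\<Sum>j\<in>A. h j j)
      + ((\<Sum>j\<in>A. \<Sum>i\<in>A. ?g j i) + (\<Sum>j\<in>A. \<Sum>i\<in>A. if before I i j then h i j else 0))"
    by (simp add: split sum.distrib)
  have "(\<Sum>j\<in>A. \<Sum>i\<in>A. ?g j i) + (\<Sum>j\<in>A. \<Sum>i\<in>A. if before I i j then h i j else 0)
      = (\<Sum>j\<in>A. \<Sum>i\<in>A. if before I i j then h j i + h i j else 0)"
    unfolding sum.distrib [symmetric] by (intro sum.cong) auto
  also have "\<dots> = (\<Sum>j\<in>A. \<Sum>i | i \<in> A \<and> before I i j. h j i + h i j)"
    using assms by (simp add: sum.If_cases Int_def)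
  finally show ?thesis using eq by simp
qed

text \<open>Division by the finite, non-zero \<open>k\<close> is monotone. This carries a bound
  against every offline schedule over to the optimum, whether or not the infimum is
  attained.\<close>

lemma ennreal_le_mult_INF:
  fixes a k :: ennreal
  assumes "k \<noteq> 0" and "k \<noteq> top" and "\<And>x. x \<in> X \<Longrightarrow> a \<le> k * f x"
  shows "a \<le> k * (INF x\<in>X. f x)"
proof -
  have "a / k \<le> (INF x\<in>X. f x)"
  proof (rule INF_greatest)
    fix x assume "x \<in> X"
    then have "a / k \<le> f x * k / k"
      using assms(3) by (intro divide_right_mono_ennreal) (simp add: mult.commute)
    then show "a / k \<le> f x" using assms(1,2) by (simp add: ennreal_mult_divide_eq)
  qed
  then have "k * (a / k) \<le> k * (INF x\<in>X. f x)" by (intro mult_left_mono) auto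
  moreover have "k * (a / k) = a"
    using assms(1,2) by (simp add: ennreal_times_divide mult.commute[of k] ennreal_mult_divide_eq)
  ultimately show ?thesis by simp
qed

section \<open>Runs of the algorithm\<close>

lemma remaining_Suc:
  "remaining I S j (Suc t) = remaining I S j t - of_bool (S t = Some j)"
proof -
  have "{s. s < Suc t \<and> S s = Some j} = {s. s < t \<and> S s = Some j} \<union> {s. s = t \<and> S t = Some j}"
    by (auto simp: less_Suc_eq)
  moreover have "card \<dots> = card {s. s < t \<and> S s = Some j} + card {s. s = t \<and> S t = Some j}"
    by (intro card_Un_disjoint) auto
  ultimately show ?thesis by (simp add: remaining_def)
qed

lemma remaining_antimono: "remaining I S j u \<le> remaining I S j t" if "t \<le> u"
  using that by (induction u rule: dec_induct) (auto simp: remaining_Suc)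

lemma remaining_le_ptime: "remaining I S j t \<le> real (ptime I j)"
  by (simp add: remaining_def)

text \<open>Remaining times are integers, so an unfinished job always fills a whole slot.\<close>

lemma one_le_remaining: "1 \<le> remaining I S j t" if "0 < remaining I S j t"
  using that by (simp add: remaining_def)

lemma sum_scheduled_eq:
  assumes "t \<le> u"
  shows "(\<Sum>s=t..<u. of_bool (S s = Some j)) = remaining I S j t - remaining I S j u"
  using assms by (induction u rule: dec_induct) (simp_all add: remaining_Suc)

locale rejection_run =
  fixes I :: flow_instance and \<epsilon> :: real and S :: "nat \<Rightarrow> nat option" and R :: "nat set"
  assumes valid: "valid_instance I" and run: "A_run I \<epsilon> S R" and eps_pos: "0 < \<epsilon>"
    and eps_inverse: "1 / \<epsilon> \<in> \<int>"
begin

abbreviation accepted :: "nat set" where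
  "accepted \<equiv> jobs I - R"

abbreviation rem :: "nat \<Rightarrow> nat \<Rightarrow> real" where
  "rem \<equiv> remaining I S"

abbreviation total_cost :: real where
  "total_cost \<equiv> \<Sum>j\<in>jobs I. weight I j * real (ptime I j)"

text \<open>Differs from \<open>rem\<close> before the release, where \<open>rem\<close> already is
  the full processing time.\<close>

definition pending :: "nat \<Rightarrow> nat \<Rightarrow> real" where
  "pending j t = (if release I j \<le> t then rem j t else 0)"

text \<open>The variable \<beta> of the dual fitting.\<close>

definition pending_weight :: "nat \<Rightarrow> real" where
  "pending_weight t = (\<Sum>j\<in>accepted. density I j * pending j t)"

text \<open>Measures how far the slot deviates from highest density first: the waiting weight that
  is denser than the running job.\<close>

definition excess :: "nat \<Rightarrow> real" where
  "excess t = (case S t of None \<Rightarrow> 0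
     | Some j \<Rightarrow> \<Sum>i | i \<in> accepted \<and> density I j < density I i. density I i * pending i t)"

lemma finite_jobs [simp]: "finite (jobs I)"
  using valid by (simp add: valid_instance_def)

lemma ptime_pos: "j \<in> jobs I \<Longrightarrow> 0 < ptime I j"
  and weight_pos: "j \<in> jobs I \<Longrightarrow> 0 < weight I j"
  using valid by (simp_all add: valid_instance_def)

lemma density_pos: "j \<in> jobs I \<Longrightarrow> 0 < density I j"
  by (simp add: density_def ptime_pos weight_pos)

lemma density_times_ptime: "j \<in> jobs I \<Longrightarrow> density I j * real (ptime I j) = weight I j"
  using ptime_pos by (simp add: density_def)

lemma rejected_eq: "R = {j \<in> jobs I. rejects_plus I \<epsilon> S R j \<or> rejects_minus I \<epsilon> S R j}"
  using run by (simp add: A_run_def)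

lemma run_at:
  "if \<exists>j. must_continue I \<epsilon> S j t then S t = S (t - 1)
   else if active I S R t = {} then S t = None
   else \<exists>j \<in> active I S R t. S t = Some j \<and> (\<forall>i \<in> active I S R t. density I i \<le> density I j)"
  using run unfolding A_run_def by blast

lemma run_continue: "S t = Some j" if "must_continue I \<epsilon> S j t"
proof -
  have "\<exists>j. must_continue I \<epsilon> S j t" using that by blast
  then have "S t = S (t - 1)" using run_at[of t] by presburger
  then show ?thesis using that unfolding must_continue_def by metis
qed

lemma run_idle: "active I S R t = {}" if "S t = None"
proof -
  have "\<not> (\<exists>j. must_continue I \<epsilon> S j t)"
    using that run_continue[of _ t] by fastforce
  then show ?thesis using run_at[of t] that by (metis option.distinct(1))
qed

lemma run_fresh:
  assumes "S t = Some j" and "\<not> must_continue I \<epsilon> S j t"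
  shows "j \<in> active I S R t" and "\<And>i. i \<in> active I S R t \<Longrightarrow> density I i \<le> density I j"
proof -
  have "\<not> (\<exists>j. must_continue I \<epsilon> S j t)"
    using assms run_continue[of _ t] by fastforce
  then have "\<exists>j \<in> active I S R t. S t = Some j \<and> (\<forall>i \<in> active I S R t. density I i \<le> density I j)"
    using run_at[of t] assms(1) by (metis option.distinct(1))
  then show "j \<in> active I S R t" "\<And>i. i \<in> active I S R t \<Longrightarrow> density I i \<le> density I j"
    using assms(1) by auto
qed

lemma scheduled_active: "S t = Some j \<Longrightarrow> j \<in> active I S R t"
proof (induction t)
  case 0
  then show ?case by (rule run_fresh) (simp add: must_continue_def)
next
  case (Suc t)
  show ?case
  proof (cases "must_continue I \<epsilon> S j (Suc t)")
    case True
    then show ?thesis using Suc.IH by (auto simp: must_continue_def active_def)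
  next
    case False
    with Suc.prems show ?thesis by (rule run_fresh)
  qed
qed

lemma scheduled_accepted: "S t = Some j \<Longrightarrow> j \<in> accepted"
  and scheduled_released: "S t = Some j \<Longrightarrow> release I j \<le> t"
  using scheduled_active by (auto simp: active_def)

lemma remaining_nonneg: "0 \<le> rem j t"
proof (induction t)
  case 0
  then show ?case by (simp add: remaining_def)
next
  case (Suc t)
  then show ?case
    using scheduled_active[of t j] one_le_remaining[of I S j t]
    by (auto simp: remaining_Suc active_def)
qed

lemma remaining_before_release: "rem j t = real (ptime I j)" if "t \<le> release I j"
proof -
  have "{s. s < t \<and> S s = Some j} = {}"
    using that scheduled_released by fastforce
  then show ?thesis by (simp add: remaining_def)
qed

lemma pending_nonneg: "0 \<le> pending j t"
  by (simp add: pending_def remaining_nonneg)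

lemma pending_le_remaining: "pending j t \<le> rem j t"
  by (simp add: pending_def remaining_nonneg)

lemma pending_le_ptime: "pending j t \<le> real (ptime I j)"
  using pending_le_remaining remaining_le_ptime by (rule order_trans)

lemma pending_weight_nonneg: "0 \<le> pending_weight t"
  unfolding pending_weight_def
  by (intro sum_nonneg mult_nonneg_nonneg pending_nonneg) (auto intro: less_imp_le density_pos)

lemma idle_pending: "pending j t = 0" if "S t = None" "j \<in> accepted"
  using that run_idle[of t] remaining_nonneg[of j t] by (force simp: pending_def active_def)

lemma sum_scheduled_le_ptime: "(\<Sum>t<T. of_bool (S t = Some j)) \<le> real (ptime I j)"
  using sum_scheduled_eq[of 0 T S j I] remaining_nonneg[of j T]
  by (simp add: atLeast0LessThan remaining_le_ptime order_trans[OF _ remaining_le_ptime[of I S j 0]])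

section \<open>The delay caused by uninterrupted jobs\<close>

text \<open>When \<open>j\<close> started, no active job was denser; a denser job active at
  \<open>t\<close> cannot have been there.\<close>

lemma released_after_start:
  assumes "must_continue I \<epsilon> S j t" and "i \<in> active I S R t" and "density I j < density I i"
  shows "start_time S j < release I i"
proof (rule ccontr)
  let ?s = "start_time S j"
  assume "\<not> ?s < release I i"
  have prev: "S (t - 1) = Some j" and "0 < t" using assms(1) by (auto simp: must_continue_def)
  have S_start: "S ?s = Some j"
    unfolding start_time_def using prev by (rule LeastI)
  have "?s \<le> t - 1"
    unfolding start_time_def using prev by (rule Least_le)
  then have "rem i t \<le> rem i ?s" by (intro remaining_antimono) simp
  then have "i \<in> active I S R ?s"
    using assms(2) \<open>\<not> ?s < release I i\<close> by (auto simp: active_def)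
  moreover have "\<not> must_continue I \<epsilon> S j ?s"
  proof
    assume "must_continue I \<epsilon> S j ?s"
    then have "0 < ?s" "S (?s - 1) = Some j" by (simp_all only: must_continue_def)
    moreover from this(2) have "?s \<le> ?s - 1" unfolding start_time_def by (rule Least_le)
    ultimately show False by simp
  qed
  ultimately show False
    using run_fresh(2)[OF S_start] assms(3) by fastforce
qed

text \<open>If the slot was assigned afresh, nothing denser is waiting. Otherwise \<open>j\<close>
  is continued outside L: all denser waiting jobs have arrived since its start, and their weight has
  not passed the threshold for entering L.\<close>

lemma excess_le:
  assumes "S t = Some j"
  shows "excess t \<le> weight I j / \<epsilon>"
proof -
  let ?X = "{i. i \<in> accepted \<and> density I j < density I i}"
  have j: "j \<in> jobs I" using scheduled_accepted[OF assms] by simp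
  have excess: "excess t = (\<Sum>i\<in>?X. density I i * pending i t)"
    using assms by (simp add: excess_def)
  have fin: "finite ?X" by simp
  show ?thesis
  proof (cases "must_continue I \<epsilon> S j t")
    case cont: True
    let ?Y = "{i \<in> jobs I. start_time S j < release I i \<and> release I i \<le> t}"
    have "excess t = (\<Sum>i\<in>?X \<inter> ?Y. density I i * pending i t)"
      unfolding excess
    proof (rule sum.mono_neutral_right[OF fin], blast, rule ballI)
      fix i assume i: "i \<in> ?X - ?X \<inter> ?Y"
      then have "i \<notin> active I S R t"
        using released_after_start[OF cont, of i] by (auto simp: active_def)
      then show "density I i * pending i t = 0"
        using i remaining_nonneg[of i t] by (force simp: pending_def active_def)
    qed
    also have "\<dots> \<le> (\<Sum>i\<in>?X \<inter> ?Y. weight I i)"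
    proof (intro sum_mono)
      fix i assume "i \<in> ?X \<inter> ?Y"
      then have "i \<in> jobs I" by simp
      have "density I i * pending i t \<le> density I i * real (ptime I i)"
        using density_pos[OF \<open>i \<in> jobs I\<close>] by (intro mult_left_mono pending_le_ptime) simp
      then show "density I i * pending i t \<le> weight I i"
        using density_times_ptime[OF \<open>i \<in> jobs I\<close>] by simp
    qed
    also have "\<dots> \<le> (\<Sum>i\<in>?Y. weight I i)"
      by (intro sum_mono2) (auto intro: less_imp_le weight_pos)
    also have "\<dots> \<le> weight I j / \<epsilon>"
    proof -
      \<comment> \<open>The test made after slot \<open>t - 1\<close> counts the arrivals up to and
        including time \<open>t\<close>.\<close>
      have "t - 1 < t" "Suc (t - 1) = t" "S (t - 1) = Some j" "0 < rem j t" "\<not> in_L I \<epsilon> S j t"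
        using cont by (auto simp: must_continue_def)
      then have "\<not> weight I j / \<epsilon> < sum (weight I) ?Y"
        unfolding in_L_def by fastforce
      then show ?thesis by simp
    qed
    finally show ?thesis .
  next
    case False
    with assms have max: "\<forall>i \<in> active I S R t. density I i \<le> density I j"
      using run_fresh(2) by blast
    have "density I i * pending i t = 0" if "i \<in> ?X" for i
      using that max remaining_nonneg[of i t] by (force simp: pending_def active_def)
    then have "excess t = 0" unfolding excess by (intro sum.neutral) blast
    then show ?thesis using weight_pos[OF j] eps_pos by simp
  qed
qed

text \<open>Each job runs in at most \<open>ptime\<close> many slots, and each of these has excess
  at most \<open>weight I j / \<epsilon>\<close>.\<close>

lemma sum_excess_le: "(\<Sum>t<T. excess t) \<le> total_cost / \<epsilon>"
proof -
  have "excess t \<le> (\<Sum>j\<in>jobs I. weight I j / \<epsilon> * of_bool (S t = Some j))" for t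
  proof (cases "S t")
    case None
    then show ?thesis by (simp add: excess_def)
  next
    case (Some j)
    then have "j \<in> jobs I" using scheduled_accepted by blast
    then have "(\<Sum>i\<in>jobs I. weight I i / \<epsilon> * of_bool (S t = Some i)) = weight I j / \<epsilon>"
      using Some by (simp add: of_bool_def if_distrib [of "(*) _"] sum.delta' cong: if_cong)
    then show ?thesis using excess_le[OF Some] by simp
  qed
  then have "(\<Sum>t<T. excess t) \<le> (\<Sum>t<T. \<Sum>j\<in>jobs I. weight I j / \<epsilon> * of_bool (S t = Some j))"
    by (intro sum_mono)
  also have "\<dots> = (\<Sum>j\<in>jobs I. weight I j / \<epsilon> * (\<Sum>t<T. of_bool (S t = Some j)))"
    unfolding sum_distrib_left by (rule sum.swap)
  also have "\<dots> \<le> (\<Sum>j\<in>jobs I. weight I j / \<epsilon> * real (ptime I j))"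
    using eps_pos weight_pos
    by (intro sum_mono mult_left_mono sum_scheduled_le_ptime) (auto intro: less_imp_le)
  finally show ?thesis by (simp add: sum_divide_distrib)
qed

text \<open>
  By how much \<open>j\<close> and the jobs active at its arrival delay each other under highest-density-first:
  the increase of the future fractional flow-time, apart from the cost of \<open>j\<close> on its own.
\<close>

definition increase :: "nat \<Rightarrow> real" where
  "increase j = alpha_plus I S R j + alpha_minus I S R j"

text \<open>The classes only decide which table a term belongs to. A lower class implies a lower
  density, so all three sums price work at the smaller of the two densities.\<close>

lemma increase_eq:
  assumes j: "j \<in> jobs I"
  shows "increase j = (\<Sum>i | i \<in> accepted \<and> before I i j.
    real (ptime I j) * rem i (release I j) * min (density I i) (density I j))"
proof -
  let ?r = "release I j"
  let ?f = "\<lambda>i. real (ptime I j) * rem i ?r * min (density I i) (density I j)"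
  let ?A = "active_at_arrival I S R j" and ?D = "D_plus I S R j"
  let ?Dge = "{i. i \<in> ?D \<and> density I i \<ge> density I j}"
  let ?Dlt = "{i. i \<in> ?D \<and> density I i < density I j}"
  have A: "?A \<subseteq> jobs I" by (auto simp: active_at_arrival_def active_def)
  then have fin: "finite ?A" using finite_jobs finite_subset by blast
  have D: "?D \<subseteq> ?A" by (auto simp: D_plus_def)
  have "weight I j * (\<Sum>i\<in>?Dge. rem i ?r) = (\<Sum>i\<in>?Dge. ?f i)"
    unfolding sum_distrib_left
    by (intro sum.cong) (auto simp: density_times_ptime[OF j, symmetric] min_def)
  moreover have "real (ptime I j) * (\<Sum>i\<in>?Dlt. remaining_weight I S i ?r) = (\<Sum>i\<in>?Dlt. ?f i)"
    unfolding sum_distrib_left by (intro sum.cong) (auto simp: remaining_weight_def min_def)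
  moreover have "alpha_minus I S R j = (\<Sum>i\<in>?A - ?D. ?f i)"
    unfolding alpha_minus_def D_minus_def sum_distrib_left
  proof (intro sum.cong refl)
    fix i assume i: "i \<in> ?A - ?D"
    then have "floor2 (density I i) < floor2 (density I j)" by (auto simp: D_plus_def)
    moreover have "i \<in> jobs I" using i A by blast
    ultimately have "density I i < density I j"
      using floor2_mono[OF density_pos[OF j], of "density I i"] by fastforce
    then show "real (ptime I j) * remaining_weight I S i ?r = ?f i"
      by (simp add: remaining_weight_def)
  qed
  moreover have "(\<Sum>i\<in>?Dge. ?f i) + (\<Sum>i\<in>?Dlt. ?f i) = (\<Sum>i\<in>?D. ?f i)"
    using finite_subset[OF D fin]
    by (subst sum.union_disjoint [symmetric]) (auto intro: sum.cong)
  moreover have "(\<Sum>i\<in>?D. ?f i) + (\<Sum>i\<in>?A - ?D. ?f i) = (\<Sum>i\<in>?A. ?f i)"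
    using sum.subset_diff[OF D fin, of ?f] by simp
  moreover have "(\<Sum>i\<in>?A. ?f i) = (\<Sum>i | i \<in> accepted \<and> before I i j. ?f i)"
  proof (rule sum.mono_neutral_left)
    show "\<forall>i\<in>{i. i \<in> accepted \<and> before I i j} - ?A. ?f i = 0"
    proof
      fix i assume "i \<in> {i. i \<in> accepted \<and> before I i j} - ?A"
      then show "?f i = 0"
        using remaining_nonneg[of i ?r]
        by (force simp: active_at_arrival_def active_def before_def)
    qed
  qed (auto simp: active_at_arrival_def active_def)
  ultimately show ?thesis unfolding increase_def alpha_plus_def by linarith
qed

lemma alpha_plus_nonneg: "j \<in> jobs I \<Longrightarrow> 0 \<le> alpha_plus I S R j"
  unfolding alpha_plus_def remaining_weight_def D_plus_def active_at_arrival_def active_def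
  by (intro add_nonneg_nonneg mult_nonneg_nonneg sum_nonneg remaining_nonneg)
     (auto intro: less_imp_le weight_pos density_pos)

lemma alpha_minus_nonneg: "0 \<le> alpha_minus I S R j"
  unfolding alpha_minus_def remaining_weight_def D_minus_def active_at_arrival_def active_def
  by (intro mult_nonneg_nonneg sum_nonneg remaining_nonneg)
     (auto intro: less_imp_le density_pos)

section \<open>The flow-time of \<A> against the increases of the accepted jobs\<close>

text \<open>The product \<open>rem i t * rem j t\<close> is a potential: a slot for \<open>i\<close>
  lowers it by \<open>rem j t\<close>, a slot for \<open>j\<close> by \<open>rem i t\<close>. So the
  sum telescopes, in whatever order the two jobs run.\<close>

lemma sum_pair_le:
  assumes "i \<noteq> j" and "0 \<le> m"
  shows "(\<Sum>t=r..<T. (of_bool (S t = Some i) * rem j t + of_bool (S t = Some j) * rem i t) * m)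
    \<le> rem i r * rem j r * m"
proof (cases "r \<le> T")
  case True
  have "(\<Sum>t=r..<T. (of_bool (S t = Some i) * rem j t + of_bool (S t = Some j) * rem i t) * m)
      = rem i r * rem j r * m - rem i T * rem j T * m"
    using True
    by (induction T rule: dec_induct) (use assms(1) in \<open>auto simp: remaining_Suc algebra_simps\<close>)
  then show ?thesis using assms(2) remaining_nonneg by simp
next
  case False
  then show ?thesis using assms(2) remaining_nonneg by simp
qed

text \<open>Only the running job contributes to the outer sum. The minimum counts jobs at most as
  dense as it in full; the denser ones are covered by \<open>excess\<close>.\<close>

lemma pending_weight_le:
  "pending_weight t \<le> excess t
    + (\<Sum>j\<in>accepted. \<Sum>i\<in>accepted.
        of_bool (S t = Some j) * (pending i t * min (density I i) (density I j)))"
proof (cases "S t")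
  case None
  then show ?thesis by (simp add: pending_weight_def excess_def idle_pending)
next
  case (Some k)
  then have k: "k \<in> accepted" by (rule scheduled_accepted)
  have "(\<Sum>j\<in>accepted. \<Sum>i\<in>accepted.
        of_bool (S t = Some j) * (pending i t * min (density I i) (density I j)))
    = (\<Sum>j\<in>accepted. if j = k then
        \<Sum>i\<in>accepted. pending i t * min (density I i) (density I k) else 0)"
    using Some by (intro sum.cong) auto
  also have "\<dots> = (\<Sum>i\<in>accepted. pending i t * min (density I i) (density I k))"
    using k by (simp add: sum.delta)
  finally have eq: "(\<Sum>j\<in>accepted. \<Sum>i\<in>accepted.
        of_bool (S t = Some j) * (pending i t * min (density I i) (density I j)))
    = (\<Sum>i\<in>accepted. pending i t * min (density I i) (density I k))" .
  have "excess t = (\<Sum>i\<in>accepted. if density I k < density I i then density I i * pending i t else 0)"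
    using Some by (simp add: excess_def sum.If_cases Int_def cong: conj_cong)
  moreover have "pending_weight t
    \<le> (\<Sum>i\<in>accepted. (if density I k < density I i then density I i * pending i t else 0)
        + pending i t * min (density I i) (density I k))"
    unfolding pending_weight_def
  proof (intro sum_mono)
    fix i assume "i \<in> accepted"
    show "density I i * pending i t
      \<le> (if density I k < density I i then density I i * pending i t else 0)
        + pending i t * min (density I i) (density I k)"
      using pending_nonneg[of i t] density_pos[of k] k by (auto simp: min_def)
  qed
  ultimately show ?thesis unfolding eq by (simp add: sum.distrib)
qed

text \<open>The delay within a pair of jobs is covered by one summand of the increase of the later
  job, the delay of a job by itself by \<open>total_cost\<close>, and the deviation from density
  order by \<open>sum_excess_le\<close>.\<close>

lemma flow_le_increases:
  "(\<Sum>t<T. pending_weight t)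
    \<le> (\<Sum>j\<in>accepted. increase j) + total_cost + total_cost / \<epsilon>"
proof -
  \<comment> \<open>\<open>h j i\<close> is the delay of \<open>i\<close> during the slots of
    \<open>j\<close>, priced at the smaller density.\<close>
  define h where "h j i = (\<Sum>t<T. of_bool (S t = Some j) *
      (pending i t * min (density I i) (density I j)))" for j i
  have "(\<Sum>t<T. pending_weight t) \<le> (\<Sum>t<T. excess t + (\<Sum>j\<in>accepted. \<Sum>i\<in>accepted.
        of_bool (S t = Some j) * (pending i t * min (density I i) (density I j))))"
    by (intro sum_mono pending_weight_le)
  also have "\<dots> = (\<Sum>t<T. excess t) + (\<Sum>j\<in>accepted. \<Sum>i\<in>accepted. h j i)"
    unfolding sum.distrib h_def
    by (intro arg_cong2[where f = "(+)"] refl) (subst sum.swap, intro sum.cong refl sum.swap)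
  finally have flow: "(\<Sum>t<T. pending_weight t)
      \<le> (\<Sum>t<T. excess t) + (\<Sum>j\<in>accepted. \<Sum>i\<in>accepted. h j i)" .
  have pairs: "(\<Sum>j\<in>accepted. \<Sum>i\<in>accepted. h j i) = (\<Sum>j\<in>accepted. h j j)
      + (\<Sum>j\<in>accepted. \<Sum>i | i \<in> accepted \<and> before I i j. h j i + h i j)"
    by (intro sum_pairs_eq) simp
  have "(\<Sum>j\<in>accepted. h j j) \<le> (\<Sum>j\<in>accepted. weight I j * real (ptime I j))"
  proof (intro sum_mono)
    fix j assume "j \<in> accepted"
    then have j: "j \<in> jobs I" by simp
    have "h j j \<le> (\<Sum>t<T. of_bool (S t = Some j) * (real (ptime I j) * density I j))"
      unfolding h_def min.idem
      using density_pos[OF j]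
      by (intro sum_mono mult_left_mono mult_right_mono pending_le_ptime) auto
    also have "\<dots> = (\<Sum>t<T. of_bool (S t = Some j)) * weight I j"
      unfolding sum_distrib_right density_times_ptime[OF j, symmetric]
      by (intro sum.cong) (simp_all add: mult_ac)
    also have "\<dots> \<le> real (ptime I j) * weight I j"
      using weight_pos[OF j] by (intro mult_right_mono sum_scheduled_le_ptime) simp
    finally show "h j j \<le> weight I j * real (ptime I j)" by (simp add: mult.commute)
  qed
  also have "\<dots> \<le> total_cost"
    using weight_pos by (intro sum_mono2 mult_nonneg_nonneg) (auto intro: less_imp_le)
  finally have diag: "(\<Sum>j\<in>accepted. h j j) \<le> total_cost" .
  have "(\<Sum>j\<in>accepted. \<Sum>i | i \<in> accepted \<and> before I i j. h j i + h i j)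
      \<le> (\<Sum>j\<in>accepted. increase j)"
  proof (intro sum_mono)
    fix j assume "j \<in> accepted"
    then have j: "j \<in> jobs I" by simp
    show "(\<Sum>i | i \<in> accepted \<and> before I i j. h j i + h i j) \<le> increase j"
      unfolding increase_eq[OF j]
    proof (intro sum_mono)
      fix i assume "i \<in> {i. i \<in> accepted \<and> before I i j}"
      then have i: "i \<in> jobs I" and before: "before I i j" by auto
      define m where "m = min (density I i) (density I j)"
      have "h j i + h i j = (\<Sum>t<T.
          (of_bool (S t = Some i) * pending j t + of_bool (S t = Some j) * pending i t) * m)"
        by (simp add: h_def m_def sum.distrib [symmetric] algebra_simps min.commute)
      also have "\<dots> = (\<Sum>t=release I j..<T.
          (of_bool (S t = Some i) * pending j t + of_bool (S t = Some j) * pending i t) * m)"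
      proof (rule sum.mono_neutral_right)
        show "\<forall>t\<in>{..<T} - {release I j..<T}.
          (of_bool (S t = Some i) * pending j t + of_bool (S t = Some j) * pending i t) * m = 0"
          using scheduled_released[of _ j] by (auto simp: pending_def) 
      qed auto
      also have "\<dots> = (\<Sum>t=release I j..<T.
          (of_bool (S t = Some i) * rem j t + of_bool (S t = Some j) * rem i t) * m)"
        using before by (intro sum.cong) (auto simp: pending_def before_def)
      also have "\<dots> \<le> rem i (release I j) * rem j (release I j) * m"
        using before density_pos[OF i] density_pos[OF j]
        by (intro sum_pair_le) (auto simp: m_def before_def)
      also have "\<dots> = real (ptime I j) * rem i (release I j) * m"
        by (simp add: remaining_before_release mult_ac)
      finally show "h j i + h i j \<le> real (ptime I j) * rem i (release I j) *
          min (density I i) (density I j)" unfolding m_def .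
    qed
  qed
  then show ?thesis using flow pairs diag sum_excess_le[of T] by linarith
qed

section \<open>Rejections within the buckets\<close>

abbreviation period :: nat where
  "period \<equiv> nat \<lfloor>1 / \<epsilon>\<rfloor>"

lemma real_period: "real period = 1 / \<epsilon>"
proof -
  have "real_of_int \<lfloor>1 / \<epsilon>\<rfloor> = 1 / \<epsilon>" using eps_inverse by (rule of_int_floor)
  moreover have "0 < 1 / \<epsilon>" using eps_pos by simp
  ultimately show ?thesis by simp
qed

lemma period_pos: "0 < period"
proof -
  have "0 < real period" unfolding real_period using eps_pos by simp
  then show ?thesis by (simp only: of_nat_0_less_iff)
qed

lemma one_le_eps_inverse: "1 \<le> 1 / \<epsilon>"
proof -
  have "1 \<le> real period" using period_pos by linarith
  then show ?thesis unfolding real_period .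
qed

lemma rejected_subset: "R \<subseteq> jobs I"
  using rejected_eq by blast

text \<open>A bucket fixes both \<open>\<alpha>\<^sup>+ / w\<close> and \<open>w\<close> up to a
  factor 2, hence their product up to 4, and its first job is rejected. Unassigned jobs have
  \<alpha> below \<open>w * p / \<epsilon>\<close> by the rule.\<close>

lemma sum_alpha_plus_le:
  "(\<Sum>j\<in>jobs I. alpha_plus I S R j) \<le> total_cost / \<epsilon> + 4 / \<epsilon> * (\<Sum>j\<in>R. alpha_plus I S R j)"
proof -
  let ?\<alpha> = "alpha_plus I S R" and ?b = "bucket_plus I S R"
  define A where "A = {j \<in> jobs I. assigned_plus I \<epsilon> S R j}"
  have finA: "finite A" by (simp add: A_def)
  have bucket: "(\<Sum>j | j \<in> A \<and> ?b j = b. ?\<alpha> j)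
      \<le> 4 / \<epsilon> * (\<Sum>j | j \<in> {j \<in> A. rejects_plus I \<epsilon> S R j} \<and> ?b j = b. ?\<alpha> j)" for b
  proof -
    let ?J = "{j. j \<in> A \<and> ?b j = b}"
    define c where "c = (2 powi fst b * 2 powi snd b :: real)"
    have "c \<le> ?\<alpha> j \<and> ?\<alpha> j \<le> 4 * c" if "j \<in> ?J" for j
    proof -
      have j: "j \<in> jobs I" and b: "b = (floor2 (?\<alpha> j / weight I j), floor2 (weight I j))"
        and "weight I j * real (ptime I j) / \<epsilon> \<le> ?\<alpha> j"
        using that by (auto simp: A_def bucket_plus_def assigned_plus_def)
      moreover have "0 < weight I j * real (ptime I j) / \<epsilon>"
        using weight_pos[OF j] ptime_pos[OF j] eps_pos by simp
      ultimately have pos: "0 < ?\<alpha> j / weight I j" using weight_pos[OF j] by simp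
      have eq: "?\<alpha> j = ?\<alpha> j / weight I j * weight I j" using weight_pos[OF j] by simp
      have "c \<le> ?\<alpha> j / weight I j * weight I j"
        unfolding c_def b fst_conv snd_conv
        using pos weight_pos[OF j] by (intro mult_mono floor2_le) auto
      moreover have "?\<alpha> j / weight I j * weight I j \<le> (2 * 2 powi fst b) * (2 * 2 powi snd b)"
        unfolding b fst_conv snd_conv
        using pos weight_pos[OF j] less_floor2[OF pos] less_floor2[OF weight_pos[OF j]]
        by (intro mult_mono) auto
      ultimately show ?thesis using eq by (simp add: c_def)
    qed
    then have "(\<Sum>j\<in>?J. ?\<alpha> j)
        \<le> 4 * real period * (\<Sum>j | j \<in> ?J \<and> card {i \<in> ?J. before I i j} mod period = 0. ?\<alpha> j)"
      using finA period_pos by (intro sum_le_sum_rank_multiples[where c = c]) (auto simp: c_def)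
    also have "{j. j \<in> ?J \<and> card {i \<in> ?J. before I i j} mod period = 0}
        = {j. j \<in> {j \<in> A. rejects_plus I \<epsilon> S R j} \<and> ?b j = b}"
    proof -
      have "card {i \<in> ?J. before I i j} = earlier_plus I \<epsilon> S R j" if "j \<in> ?J" for j
        unfolding earlier_plus_def using that by (intro arg_cong[where f = card]) (auto simp: A_def)
      then show ?thesis by (auto simp: rejects_plus_def A_def)
    qed
    finally show ?thesis by (simp add: real_period)
  qed
  have "(\<Sum>j\<in>A. ?\<alpha> j) = (\<Sum>b\<in>?b ` A. \<Sum>j | j \<in> A \<and> ?b j = b. ?\<alpha> j)"
    using finA by (rule sum.image_gen)
  also have "\<dots> \<le> 4 / \<epsilon> * (\<Sum>b\<in>?b ` A. \<Sum>j | j \<in> {j \<in> A. rejects_plus I \<epsilon> S R j} \<and> ?b j = b. ?\<alpha> j)"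
    unfolding sum_distrib_left[of _ _ "?b ` A"] by (intro sum_mono bucket)
  also have "(\<Sum>b\<in>?b ` A. \<Sum>j | j \<in> {j \<in> A. rejects_plus I \<epsilon> S R j} \<and> ?b j = b. ?\<alpha> j)
      = (\<Sum>j | j \<in> A \<and> rejects_plus I \<epsilon> S R j. ?\<alpha> j)"
    using finA by (intro sum.group) auto
  finally have A: "(\<Sum>j\<in>A. ?\<alpha> j) \<le> 4 / \<epsilon> * (\<Sum>j | j \<in> A \<and> rejects_plus I \<epsilon> S R j. ?\<alpha> j)" .
  have "(\<Sum>j | j \<in> A \<and> rejects_plus I \<epsilon> S R j. ?\<alpha> j) \<le> (\<Sum>j\<in>R. ?\<alpha> j)"
  proof (intro sum_mono2)
    show "finite R" using rejected_subset finite_jobs by (rule finite_subset)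
    show "{j. j \<in> A \<and> rejects_plus I \<epsilon> S R j} \<subseteq> R"
      by (subst rejected_eq) (auto simp: A_def)
    show "0 \<le> ?\<alpha> j" if "j \<in> R - {j. j \<in> A \<and> rejects_plus I \<epsilon> S R j}" for j
      using that rejected_subset by (intro alpha_plus_nonneg) auto
  qed
  then have "4 / \<epsilon> * (\<Sum>j | j \<in> A \<and> rejects_plus I \<epsilon> S R j. ?\<alpha> j) \<le> 4 / \<epsilon> * (\<Sum>j\<in>R. ?\<alpha> j)"
    using eps_pos by (intro mult_left_mono) auto
  with A have "(\<Sum>j\<in>A. ?\<alpha> j) \<le> 4 / \<epsilon> * (\<Sum>j\<in>R. ?\<alpha> j)" by (rule order_trans)
  moreover have "(\<Sum>j\<in>jobs I - A. ?\<alpha> j) \<le> (\<Sum>j\<in>jobs I - A. weight I j * real (ptime I j) / \<epsilon>)"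
    by (intro sum_mono) (auto simp: A_def assigned_plus_def)
  moreover have "\<dots> \<le> total_cost / \<epsilon>"
    unfolding sum_divide_distrib using eps_pos weight_pos
    by (intro sum_mono2 divide_nonneg_pos mult_nonneg_nonneg) (auto intro: less_imp_le)
  moreover have "(\<Sum>j\<in>jobs I. ?\<alpha> j) = (\<Sum>j\<in>jobs I - A. ?\<alpha> j) + (\<Sum>j\<in>A. ?\<alpha> j)"
    by (intro sum.subset_diff) (auto simp: A_def)
  ultimately show ?thesis by linarith
qed

definition buckets_minus :: "(int \<times> int \<times> int) set" where
  "buckets_minus = bucket_minus I S R ` {j \<in> jobs I. assigned_minus I \<epsilon> S R j}"

lemma alpha_minus_pos: "0 < alpha_minus I S R j" if "j \<in> jobs I" "assigned_minus I \<epsilon> S R j"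
proof -
  have "0 \<le> weight I j * real (ptime I j) / \<epsilon>"
    using weight_pos[OF that(1)] eps_pos by simp
  then show ?thesis using that(2) unfolding assigned_minus_def by linarith
qed

text \<open>Here the bucket fixes \<alpha> itself up to a factor 2. The last term is the price of
  the incomplete block of each non-empty bucket; bounding it takes the comparison of
  volumes.\<close>

lemma sum_alpha_minus_le:
  "(\<Sum>j\<in>jobs I. alpha_minus I S R j)
    \<le> total_cost / \<epsilon> + 2 / \<epsilon> * (\<Sum>j\<in>R. alpha_minus I S R j)
      + 2 / \<epsilon> * (\<Sum>b\<in>buckets_minus. 2 powi fst b)"
proof -
  let ?\<alpha> = "alpha_minus I S R" and ?b = "bucket_minus I S R"
  define A where "A = {j \<in> jobs I. assigned_minus I \<epsilon> S R j}"
  have finA: "finite A" by (simp add: A_def)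
  have bucket: "(\<Sum>j | j \<in> A \<and> ?b j = b. ?\<alpha> j)
      \<le> 2 / \<epsilon> * ((\<Sum>j | j \<in> {j \<in> A. rejects_minus I \<epsilon> S R j} \<and> ?b j = b. ?\<alpha> j) + 2 powi fst b)" for b
  proof -
    let ?J = "{j. j \<in> A \<and> ?b j = b}"
    have "2 powi fst b \<le> ?\<alpha> j \<and> ?\<alpha> j \<le> 2 * 2 powi fst b" if "j \<in> ?J" for j
    proof -
      have pos: "0 < ?\<alpha> j" and b: "fst b = floor2 (?\<alpha> j)"
        using that alpha_minus_pos by (auto simp: A_def bucket_minus_def)
      show ?thesis using floor2_le[OF pos] less_floor2[OF pos] by (simp add: b)
    qed
    then have "(\<Sum>j\<in>?J. ?\<alpha> j)
        \<le> 2 * real period * (\<Sum>j | j \<in> ?J \<and> Suc (card {i \<in> ?J. before I i j}) mod period = 0. ?\<alpha> j)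
          + 2 * real period * 2 powi fst b"
      using finA period_pos by (intro sum_le_sum_Suc_rank_multiples) auto
    also have "{j. j \<in> ?J \<and> Suc (card {i \<in> ?J. before I i j}) mod period = 0}
        = {j. j \<in> {j \<in> A. rejects_minus I \<epsilon> S R j} \<and> ?b j = b}"
    proof -
      have "card {i \<in> ?J. before I i j} = earlier_minus I \<epsilon> S R j" if "j \<in> ?J" for j
        unfolding earlier_minus_def using that by (intro arg_cong[where f = card]) (auto simp: A_def)
      then show ?thesis by (auto simp: rejects_minus_def A_def)
    qed
    finally show ?thesis by (simp add: real_period distrib_left)
  qed
  have "(\<Sum>j\<in>A. ?\<alpha> j) = (\<Sum>b\<in>?b ` A. \<Sum>j | j \<in> A \<and> ?b j = b. ?\<alpha> j)"
    using finA by (rule sum.image_gen)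
  also have "\<dots> \<le> 2 / \<epsilon> * (\<Sum>b\<in>?b ` A.
      (\<Sum>j | j \<in> {j \<in> A. rejects_minus I \<epsilon> S R j} \<and> ?b j = b. ?\<alpha> j) + 2 powi fst b)"
    unfolding sum_distrib_left[of _ _ "?b ` A"] by (intro sum_mono bucket)
  also have "\<dots> = 2 / \<epsilon> * ((\<Sum>b\<in>?b ` A.
      \<Sum>j | j \<in> {j \<in> A. rejects_minus I \<epsilon> S R j} \<and> ?b j = b. ?\<alpha> j) + (\<Sum>b\<in>?b ` A. 2 powi fst b))"
    by (simp only: sum.distrib)
  also have "(\<Sum>b\<in>?b ` A. \<Sum>j | j \<in> {j \<in> A. rejects_minus I \<epsilon> S R j} \<and> ?b j = b. ?\<alpha> j)
      = (\<Sum>j | j \<in> A \<and> rejects_minus I \<epsilon> S R j. ?\<alpha> j)"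
    using finA by (intro sum.group) auto
  finally have A: "(\<Sum>j\<in>A. ?\<alpha> j) \<le> 2 / \<epsilon> * ((\<Sum>j | j \<in> A \<and> rejects_minus I \<epsilon> S R j. ?\<alpha> j)
      + (\<Sum>b\<in>?b ` A. 2 powi fst b))" .
  have "(\<Sum>j | j \<in> A \<and> rejects_minus I \<epsilon> S R j. ?\<alpha> j) \<le> (\<Sum>j\<in>R. ?\<alpha> j)"
  proof (intro sum_mono2 alpha_minus_nonneg)
    show "finite R" using rejected_subset finite_jobs by (rule finite_subset)
    show "{j. j \<in> A \<and> rejects_minus I \<epsilon> S R j} \<subseteq> R"
      by (subst rejected_eq) (auto simp: A_def)
  qed
  then have "2 / \<epsilon> * ((\<Sum>j | j \<in> A \<and> rejects_minus I \<epsilon> S R j. ?\<alpha> j) + (\<Sum>b\<in>?b ` A. 2 powi fst b))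
      \<le> 2 / \<epsilon> * ((\<Sum>j\<in>R. ?\<alpha> j) + (\<Sum>b\<in>?b ` A. 2 powi fst b))"
    using eps_pos by (intro mult_left_mono) auto
  with A have "(\<Sum>j\<in>A. ?\<alpha> j) \<le> 2 / \<epsilon> * (\<Sum>j\<in>R. ?\<alpha> j) + 2 / \<epsilon> * (\<Sum>b\<in>buckets_minus. 2 powi fst b)"
    unfolding buckets_minus_def A_def[symmetric] by (simp only: distrib_left)
  moreover have "(\<Sum>j\<in>jobs I - A. ?\<alpha> j) \<le> (\<Sum>j\<in>jobs I - A. weight I j * real (ptime I j) / \<epsilon>)"
    by (intro sum_mono) (auto simp: A_def assigned_minus_def)
  moreover have "\<dots> \<le> total_cost / \<epsilon>"
    unfolding sum_divide_distrib using eps_pos weight_pos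
    by (intro sum_mono2 divide_nonneg_pos mult_nonneg_nonneg) (auto intro: less_imp_le)
  moreover have "(\<Sum>j\<in>jobs I. ?\<alpha> j) = (\<Sum>j\<in>jobs I - A. ?\<alpha> j) + (\<Sum>j\<in>A. ?\<alpha> j)"
    by (intro sum.subset_diff) (auto simp: A_def)
  ultimately show ?thesis by linarith
qed

end

section \<open>Comparison with an offline schedule\<close>

text \<open>
  \<open>left j t\<close> is the remaining processing time of \<open>j\<close> in the offline schedule. All sums over time
  are cut off at a time \<open>T\<close> at which that schedule has finished, so that it need not be
  known in advance that \<open>\<A>\<close> finishes.
\<close>

locale rejection_run_comparison = rejection_run +
  fixes left :: "nat \<Rightarrow> nat \<Rightarrow> real" and speed :: real and T :: nat
  assumes left_nonneg: "j \<in> jobs I \<Longrightarrow> 0 \<le> left j t"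
    and left_before_release: "j \<in> jobs I \<Longrightarrow> t \<le> release I j \<Longrightarrow> left j t = real (ptime I j)"
    and left_Suc_le: "j \<in> jobs I \<Longrightarrow> left j (Suc t) \<le> left j t"
    and sum_left_diff_le: "(\<Sum>j\<in>jobs I. left j t - left j (Suc t)) \<le> speed"
    and left_end: "j \<in> jobs I \<Longrightarrow> left j T = 0"
    and speed_le: "speed \<le> 2"
begin

definition offline_cost :: real where
  "offline_cost = (\<Sum>j\<in>jobs I. \<Sum>t=release I j..<T. density I j * left j t)"

abbreviation flow :: real where
  "flow \<equiv> \<Sum>t<T. pending_weight t"

abbreviation job_class :: "nat \<Rightarrow> int" where
  "job_class j \<equiv> floor2 (density I j)"

lemma release_less_end: "release I j < T" if "j \<in> jobs I"
  using left_before_release[OF that, of T] left_end[OF that] ptime_pos[OF that]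
  by (cases "T \<le> release I j") auto

lemma left_antimono: "t \<le> u \<Longrightarrow> j \<in> jobs I \<Longrightarrow> left j u \<le> left j t"
  by (induction u rule: dec_induct) (auto intro: order_trans left_Suc_le)

lemma sum_left_Suc_ge:
  assumes "A \<subseteq> jobs I"
  shows "(\<Sum>j\<in>A. left j t) - 2 \<le> (\<Sum>j\<in>A. left j (Suc t))"
proof -
  have "(\<Sum>j\<in>A. left j t - left j (Suc t)) \<le> (\<Sum>j\<in>jobs I. left j t - left j (Suc t))"
    using left_Suc_le by (intro sum_mono2 assms) auto
  then show ?thesis using sum_left_diff_le[of t] speed_le by (simp add: sum_subtractf)
qed

lemma square_sum_left_le:
  assumes "A \<subseteq> jobs I" and "u \<le> T"
  shows "(\<Sum>j\<in>A. left j u)\<^sup>2 \<le> 4 * (\<Sum>t=u..<T. \<Sum>j\<in>A. left j t)"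
  using assms left_nonneg left_end
  by (intro square_le_sum_of_slow_decrease sum_left_Suc_ge sum_nonneg sum.neutral) auto

text \<open>Even at speed 2, a job on its own costs the offline schedule a triangle of area
  \<open>p^2 / 4\<close>, times its density.\<close>

lemma total_cost_le: "total_cost \<le> 4 * offline_cost"
proof -
  have "weight I j * real (ptime I j) \<le> 4 * (\<Sum>t=release I j..<T. density I j * left j t)"
    if j: "j \<in> jobs I" for j
  proof -
    have "(real (ptime I j))\<^sup>2 \<le> 4 * (\<Sum>t=release I j..<T. left j t)"
      using square_sum_left_le[of "{j}" "release I j"] j release_less_end[OF j]
      by (simp add: left_before_release)
    then have "density I j * (real (ptime I j))\<^sup>2 \<le> density I j * (4 * (\<Sum>t=release I j..<T. left j t))"
      using density_pos[OF j] by (intro mult_left_mono) auto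
    moreover have "density I j * (real (ptime I j))\<^sup>2 = weight I j * real (ptime I j)"
      using density_times_ptime[OF j] by (simp add: power2_eq_square)
    ultimately show ?thesis by (simp add: sum_distrib_left mult_ac)
  qed
  then show ?thesis unfolding offline_cost_def sum_distrib_left[of 4] by (intro sum_mono)
qed

section \<open>Dual feasibility and weak duality\<close>

text \<open>Of the work counted in \<open>increase j\<close>, \<A> has done at most
  \<open>t - r\<close> units by time \<open>t\<close>, each priced at most at the density of
  \<open>j\<close>. The rest is priced at most at its own density and is part of
  \<open>pending_weight t\<close>. The \<open>+ 1\<close> is there to match
  \<open>sum_by_parts_linear\<close>.\<close>

lemma dual_feasible:
  assumes j: "j \<in> jobs I" and "release I j \<le> t"
  shows "increase j / real (ptime I j)
    \<le> density I j * (real t + 1 - real (release I j)) + pending_weight t"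
proof -
  let ?r = "release I j" and ?X = "{i. i \<in> accepted \<and> before I i j}"
  let ?m = "\<lambda>i. min (density I i) (density I j)"
  have fin: "finite ?X" by simp
  have "increase j / real (ptime I j) = (\<Sum>i\<in>?X. rem i ?r * ?m i)"
    using ptime_pos[OF j] by (simp add: increase_eq[OF j] sum_divide_distrib)
  also have "\<dots> = (\<Sum>i\<in>?X. rem i t * ?m i) + (\<Sum>i\<in>?X. (rem i ?r - rem i t) * ?m i)"
    by (simp add: sum.distrib [symmetric] algebra_simps)
  also have "(\<Sum>i\<in>?X. rem i t * ?m i) \<le> (\<Sum>i\<in>?X. density I i * pending i t)"
    using assms(2)
    by (intro sum_mono)
       (auto simp: pending_def before_def mult.commute[of "rem _ _"] intro!: mult_right_mono remaining_nonneg)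
  also have "\<dots> \<le> pending_weight t"
    unfolding pending_weight_def
    by (intro sum_mono2 mult_nonneg_nonneg pending_nonneg) (auto intro: less_imp_le density_pos)
  also have "(\<Sum>i\<in>?X. (rem i ?r - rem i t) * ?m i) \<le> (\<Sum>i\<in>?X. (rem i ?r - rem i t) * density I j)"
    using remaining_antimono[OF assms(2)] by (intro sum_mono mult_left_mono) auto
  also have "\<dots> = (\<Sum>s=?r..<t. \<Sum>i\<in>?X. of_bool (S s = Some i)) * density I j"
    unfolding sum_distrib_right[symmetric] sum_scheduled_eq[OF assms(2), symmetric]
    by (subst sum.swap) simp
  also have "\<dots> \<le> (\<Sum>s=?r..<t. 1) * density I j"
  proof (intro mult_right_mono sum_mono)
    fix s
    have "(\<Sum>i\<in>?X. of_bool (S s = Some i)) = (\<Sum>i\<in>?X. if i = the (S s) then of_bool (S s \<noteq> None) else (0::real))"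
      by (intro sum.cong) auto
    then show "(\<Sum>i\<in>?X. of_bool (S s = Some i)) \<le> (1::real)"
      by (simp add: sum.delta[OF fin])
  qed (use density_pos[OF j] in simp)
  also have "\<dots> \<le> density I j * (real t + 1 - real ?r)"
    using density_pos[OF j] assms(2) by (simp add: of_nat_diff mult.commute)
  finally show ?thesis by linarith
qed

text \<open>Weak duality: \<open>dual_feasible\<close> is averaged over the slots with the offline
  work \<open>y j t\<close> as weights, which add up to \<open>ptime I j\<close>. The density terms
  sum by parts to the offline cost; the pending weights are counted at most \<open>speed\<close>
  times per slot.\<close>

lemma increases_le: "(\<Sum>j\<in>jobs I. increase j) \<le> offline_cost + speed * flow"
proof -
  define y where "y j t = left j t - left j (Suc t)" for j t
  have y_nonneg: "0 \<le> y j t" if "j \<in> jobs I" for j t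
    using left_Suc_le[OF that] by (simp add: y_def)
  have "increase j \<le> (\<Sum>t=release I j..<T. density I j * left j t) + (\<Sum>t<T. y j t * pending_weight t)"
    if j: "j \<in> jobs I" for j
  proof -
    let ?r = "release I j"
    have rT: "?r \<le> T" using release_less_end[OF j] by simp
    have "(\<Sum>t=?r..<T. y j t) = real (ptime I j)"
      using sum_Suc_diff'[OF rT, of "\<lambda>t. - left j t"] left_before_release[OF j, of ?r] left_end[OF j]
      by (simp add: y_def)
    then have "increase j = (\<Sum>t=?r..<T. y j t) * (increase j / real (ptime I j))"
      using ptime_pos[OF j] by simp
    also have "\<dots> \<le> (\<Sum>t=?r..<T. y j t * (density I j * (real t + 1 - real ?r) + pending_weight t))"
      unfolding sum_distrib_right
      by (intro sum_mono mult_left_mono dual_feasible j y_nonneg) auto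
    also have "\<dots> = density I j * (\<Sum>t=?r..<T. (real t + 1 - real ?r) * y j t)
        + (\<Sum>t=?r..<T. y j t * pending_weight t)"
      by (simp add: sum_distrib_left sum.distrib [symmetric] algebra_simps)
    also have "(\<Sum>t=?r..<T. (real t + 1 - real ?r) * y j t) = (\<Sum>t=?r..<T. left j t)"
      unfolding y_def sum_by_parts_linear[OF rT] by (simp add: left_end[OF j])
    also have "(\<Sum>t=?r..<T. y j t * pending_weight t) \<le> (\<Sum>t<T. y j t * pending_weight t)"
      by (intro sum_mono2 mult_nonneg_nonneg pending_weight_nonneg y_nonneg j) auto
    finally show ?thesis by (simp add: sum_distrib_left)
  qed
  then have "(\<Sum>j\<in>jobs I. increase j)
      \<le> (\<Sum>j\<in>jobs I. (\<Sum>t=release I j..<T. density I j * left j t) + (\<Sum>t<T. y j t * pending_weight t))"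
    by (intro sum_mono)
  also have "\<dots> = offline_cost + (\<Sum>t<T. \<Sum>j\<in>jobs I. y j t * pending_weight t)"
    unfolding sum.distrib offline_cost_def
    by (intro arg_cong2[where f = "(+)"] refl sum.swap)
  also have "\<dots> = offline_cost + (\<Sum>t<T. (\<Sum>j\<in>jobs I. y j t) * pending_weight t)"
    by (simp add: sum_distrib_right)
  also have "\<dots> \<le> offline_cost + (\<Sum>t<T. speed * pending_weight t)"
    unfolding y_def
    by (intro add_left_mono sum_mono mult_right_mono sum_left_diff_le pending_weight_nonneg)
  finally show ?thesis by (simp add: sum_distrib_left)
qed

section \<open>Volumes of the density classes\<close>

definition volume :: "int \<Rightarrow> nat \<Rightarrow> real" where
  "volume k t = (\<Sum>i | i \<in> accepted \<and> k \<le> job_class i. pending i t)"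

definition offline_volume :: "int \<Rightarrow> nat \<Rightarrow> real" where
  "offline_volume k t = (\<Sum>i | i \<in> jobs I \<and> release I i \<le> t \<and> k \<le> job_class i. left i t)"

definition locked :: "int \<Rightarrow> nat \<Rightarrow> bool" where
  "locked k t \<longleftrightarrow> (\<exists>j. S t = Some j \<and> job_class j < k)"

lemma volume_nonneg: "0 \<le> volume k t"
  unfolding volume_def by (intro sum_nonneg pending_nonneg)

lemma offline_volume_nonneg: "0 \<le> offline_volume k t"
  unfolding offline_volume_def by (intro sum_nonneg left_nonneg) auto

text \<open>
  Compares the two schedules on the part of the busy period ending at \<open>u\<close> in which the volume of
  the classes from \<open>k\<close> on was never below half of its final value: the algorithm only works on
  these classes there, except in the locked slots.
\<close>

lemma volume_le:
  assumes "t0 \<le> u" and pos: "\<And>t. t0 \<le> t \<Longrightarrow> t < u \<Longrightarrow> 0 < volume k t"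
    and before: "0 < t0 \<Longrightarrow> volume k (t0 - 1) \<le> c" and "0 \<le> c"
  shows "volume k u \<le> c + offline_volume k u + (speed - 1) * (real u - real t0)
    + (\<Sum>t=t0..<u. of_bool (locked k t))"
proof -
  let ?J = "{i. i \<in> accepted \<and> k \<le> job_class i}"
  have fin: "finite ?J" by simp
  \<comment> \<open>The work on these classes is balanced: \<open>q\<close> is what remains at
    \<open>t0\<close> of older jobs, \<open>b\<close> what arrives from \<open>t0\<close> to
    \<open>u\<close>.\<close>
  define q where "q i = (if release I i < t0 then rem i t0 else 0)" for i
  define b where "b i = (if t0 \<le> release I i \<and> release I i \<le> u then real (ptime I i) else 0)" for i
  have "rem i t0 - rem i u = q i + b i - pending i u" for i
    using assms(1) by (auto simp: q_def b_def pending_def remaining_before_release)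
  then have "(\<Sum>i\<in>?J. rem i t0 - rem i u) = (\<Sum>i\<in>?J. q i) + (\<Sum>i\<in>?J. b i) - volume k u"
    by (simp add: volume_def sum.distrib sum_subtractf)
  \<comment> \<open>Positive volume rules out idle slots, so exactly the slots that are not locked
    serve these classes.\<close>
  moreover have "(\<Sum>i\<in>?J. rem i t0 - rem i u) = (\<Sum>t=t0..<u. 1 - of_bool (locked k t))"
  proof -
    have "(\<Sum>i\<in>?J. rem i t0 - rem i u) = (\<Sum>t=t0..<u. \<Sum>i\<in>?J. of_bool (S t = Some i))"
      unfolding sum_scheduled_eq[OF assms(1), symmetric] by (rule sum.swap)
    also have "\<dots> = (\<Sum>t=t0..<u. 1 - of_bool (locked k t))"
    proof (intro sum.cong refl)
      fix t assume "t \<in> {t0..<u}"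
      then have "0 < volume k t" using pos by simp
      then have "S t \<noteq> None"
        unfolding volume_def using idle_pending[of t] by (metis (no_types, lifting) less_irrefl mem_Collect_eq sum.neutral)
      then obtain j where j: "S t = Some j" by blast
      have "(\<Sum>i\<in>?J. of_bool (S t = Some i)) = (\<Sum>i\<in>?J. if i = j then 1 else (0::real))"
        using j by (intro sum.cong) auto
      also have "\<dots> = of_bool (k \<le> job_class j)"
        using scheduled_accepted[OF j] by (simp add: sum.delta[OF fin])
      finally show "(\<Sum>i\<in>?J. of_bool (S t = Some i)) = (1::real) - of_bool (locked k t)"
        using j by (auto simp: locked_def)
    qed
    finally show ?thesis .
  qed
  moreover have "(\<Sum>i\<in>?J. q i) \<le> c"
  proof (cases "t0 = 0")
    case True
    then show ?thesis using \<open>0 \<le> c\<close> by (simp add: q_def)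
  next
    case False
    have "(\<Sum>i\<in>?J. q i) \<le> volume k (t0 - 1)"
      unfolding volume_def
      using False remaining_antimono[of "t0 - 1" t0 I S]
      by (intro sum_mono) (auto simp: q_def pending_def)
    then show ?thesis using before False by linarith
  qed
  \<comment> \<open>Arrived work is either still left offline at \<open>u\<close> or was done
    offline since \<open>t0\<close>, at rate at most \<open>speed\<close>.\<close>
  moreover have "(\<Sum>i\<in>?J. b i) \<le> offline_volume k u + speed * (real u - real t0)"
  proof -
    let ?l = "\<lambda>i. if release I i \<le> u \<and> k \<le> job_class i then left i u else 0"
    have "(\<Sum>i\<in>?J. b i) \<le> (\<Sum>i\<in>?J. ?l i + (left i t0 - left i u))"
    proof (intro sum_mono)
      fix i assume "i \<in> ?J"
      then show "b i \<le> ?l i + (left i t0 - left i u)"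
        using left_before_release[of i t0] left_antimono[OF assms(1), of i]
          left_nonneg[of i u] by (auto simp: b_def)
    qed
    also have "\<dots> \<le> (\<Sum>i\<in>jobs I. ?l i + (left i t0 - left i u))"
      using left_antimono[OF assms(1)] left_nonneg
      by (intro sum_mono2 add_nonneg_nonneg) auto
    also have "\<dots> = offline_volume k u + (\<Sum>i\<in>jobs I. left i t0 - left i u)"
      by (simp add: offline_volume_def sum.distrib sum.If_cases Int_def)
    also have "(\<Sum>i\<in>jobs I. left i t0 - left i u) = (\<Sum>t=t0..<u. \<Sum>i\<in>jobs I. left i t - left i (Suc t))"
    proof (subst sum.swap, intro sum.cong refl)
      fix i
      show "left i t0 - left i u = (\<Sum>t=t0..<u. left i t - left i (Suc t))"
        using sum_Suc_diff'[OF assms(1), of "\<lambda>t. - left i t"] by simp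
    qed
    also have "\<dots> \<le> (\<Sum>t=t0..<u. speed)"
      by (intro sum_mono sum_left_diff_le)
    also have "\<dots> = speed * (real u - real t0)"
      using assms(1) by (simp add: of_nat_diff)
    finally show ?thesis by simp
  qed
  moreover have "(\<Sum>t=t0..<u. 1 - of_bool (locked k t))
      = (real u - real t0) - (\<Sum>t=t0..<u. of_bool (locked k t))"
    using assms(1) by (simp add: sum_subtractf of_nat_diff)
  ultimately show ?thesis by (simp add: left_diff_distrib)
qed

text \<open>With the set of jobs frozen at time \<open>u\<close> there are no arrivals, so the
  triangle bound applies; later arrivals only add volume.\<close>

lemma square_offline_volume_le:
  assumes "u < T"
  shows "(offline_volume k u)\<^sup>2 \<le> 4 * (\<Sum>t<T. offline_volume k t)"
proof -
  let ?A = "{i. i \<in> jobs I \<and> release I i \<le> u \<and> k \<le> job_class i}"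
  have "(offline_volume k u)\<^sup>2 \<le> 4 * (\<Sum>t=u..<T. \<Sum>j\<in>?A. left j t)"
    unfolding offline_volume_def using assms by (intro square_sum_left_le) auto
  also have "\<dots> \<le> 4 * (\<Sum>t=u..<T. offline_volume k t)"
    unfolding offline_volume_def
    by (intro mult_left_mono sum_mono sum_mono2) (auto intro: left_nonneg)
  also have "\<dots> \<le> 4 * (\<Sum>t<T. offline_volume k t)"
    by (intro mult_left_mono sum_mono2 offline_volume_nonneg) auto
  finally show ?thesis .
qed

text \<open>
  The three terms cover the cases that the volume has been high for a long time, that the offline
  schedule has a high volume, too, and that \<open>\<A>\<close> has been held up by jobs of lower classes.
\<close>

definition square_bound :: "real \<Rightarrow> int \<Rightarrow> real" where
  "square_bound D k = 2 / D * (\<Sum>t<T. volume k t) + 256 * (\<Sum>t<T. offline_volume k t)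
    + 16 * (\<Sum>t<T. of_bool (locked k t) * volume k t)"

lemma square_bound_nonneg: "0 < D \<Longrightarrow> 0 \<le> square_bound D k"
  unfolding square_bound_def
  by (intro add_nonneg_nonneg mult_nonneg_nonneg sum_nonneg volume_nonneg offline_volume_nonneg) auto

lemma square_volume_le:
  assumes "0 < D" and "(speed - 1) * D \<le> 1 / 4" and "1 \<le> speed" and "u < T"
  shows "(volume k u)\<^sup>2 \<le> square_bound D k"
proof -
  define X where "X = volume k u"
  define a where "a = (\<Sum>t<T. volume k t)"
  define b where "b = (\<Sum>t<T. offline_volume k t)"
  define c where "c = (\<Sum>t<T. of_bool (locked k t) * volume k t)"
  have nonneg: "0 \<le> a" "0 \<le> b" "0 \<le> c"
    by (auto simp: a_def b_def c_def intro!: sum_nonneg volume_nonneg offline_volume_nonneg)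
  have bound: "square_bound D k = 2 / D * a + 256 * b + 16 * c"
    by (simp add: square_bound_def a_def b_def c_def)
  have "0 \<le> 2 / D * a" using assms(1) nonneg(1) by simp
  have X_nonneg: "0 \<le> X" by (simp add: X_def volume_nonneg)
  consider "X = 0" | "0 < X" using X_nonneg by linarith
  then show ?thesis
  proof cases
    case 1
    then show ?thesis unfolding X_def[symmetric] bound using nonneg \<open>0 \<le> 2 / D * a\<close> by simp
  next
    case 2
    let ?P = "\<lambda>s. s \<le> u \<and> (\<forall>t. s \<le> t \<and> t \<le> u \<longrightarrow> X / 2 \<le> volume k t)"
    \<comment> \<open>The start of the maximal stretch ending at \<open>u\<close> in which the
      volume is at least \<open>X / 2\<close>.\<close>
    define t0 where "t0 = (LEAST s. ?P s)"
    have "?P u" using 2 by (auto simp: X_def)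
    then have "?P t0" unfolding t0_def by (rule LeastI)
    then have t0: "t0 \<le> u" and half: "\<And>t. t0 \<le> t \<Longrightarrow> t \<le> u \<Longrightarrow> X / 2 \<le> volume k t" by auto
    have before: "volume k (t0 - 1) \<le> X / 2" if "0 < t0"
    proof (rule ccontr)
      assume *: "\<not> volume k (t0 - 1) \<le> X / 2"
      have "?P (t0 - 1)"
      proof (intro conjI allI impI)
        fix t assume "t0 - 1 \<le> t \<and> t \<le> u"
        then show "X / 2 \<le> volume k t" using * half[of t] by (cases "t = t0 - 1") auto
      qed (use t0 in simp)
      then have "t0 \<le> t0 - 1" unfolding t0_def by (rule Least_le)
      then show False using that by simp
    qed
    show ?thesis
    proof (cases "D * X \<le> real u - real t0")
      case True
      have "D * X * (X / 2) \<le> (real u - real t0) * (X / 2)"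
        using True X_nonneg by (intro mult_right_mono) auto
      also have "\<dots> = (\<Sum>t=t0..<u. X / 2)" using t0 by (simp add: of_nat_diff)
      also have "\<dots> \<le> (\<Sum>t=t0..<u. volume k t)"
        by (intro sum_mono half) auto
      also have "\<dots> \<le> a"
        unfolding a_def using assms(4) by (intro sum_mono2 volume_nonneg) auto
      finally have "X\<^sup>2 \<le> 2 / D * a"
        using assms(1) by (simp add: field_simps power2_eq_square)
      then show ?thesis unfolding X_def[symmetric] bound using nonneg by simp
    next
      case False
      define l where "l = (\<Sum>t=t0..<u. of_bool (locked k t) :: real)"
      have "X \<le> X / 2 + offline_volume k u + (speed - 1) * (real u - real t0) + l"
        unfolding l_def X_def
      proof (intro volume_le t0)
        show "0 < volume k t" if "t0 \<le> t" "t < u" for t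
          using half[of t] that 2 by simp
      qed (use before X_nonneg in \<open>auto simp: X_def\<close>)
      moreover have "(speed - 1) * (real u - real t0) \<le> (speed - 1) * (D * X)"
        using False assms(3) by (intro mult_left_mono) auto
      moreover have "(speed - 1) * (D * X) \<le> 1 / 4 * X"
        unfolding mult.assoc[symmetric] using assms(2) X_nonneg by (intro mult_right_mono)
      \<comment> \<open>At most \<open>X / 2\<close> is older than \<open>t0\<close> and the offline
        lead is at most \<open>X / 4\<close>; locked slots and offline volume share the remaining
        \<open>X / 4\<close>. This gives the constants of \<open>square_bound\<close>: 16 is
        \<open>8 * 2\<close>, and 256 is \<open>8^2 * 4\<close>.\<close>
      ultimately have "X / 8 \<le> l \<or> X / 8 \<le> offline_volume k u" by linarith
      then show ?thesis
      proof
        assume "X / 8 \<le> l"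
        then have "X / 8 * (X / 2) \<le> l * (X / 2)"
          using X_nonneg by (intro mult_right_mono) auto
        also have "\<dots> \<le> (\<Sum>t=t0..<u. of_bool (locked k t) * volume k t)"
          unfolding l_def sum_distrib_right
          by (intro sum_mono mult_left_mono half) auto
        also have "\<dots> \<le> c"
          unfolding c_def using assms(4) by (intro sum_mono2 mult_nonneg_nonneg volume_nonneg) auto
        finally have "X\<^sup>2 \<le> 16 * c" by (simp add: power2_eq_square)
        then show ?thesis
          unfolding X_def[symmetric] bound using nonneg \<open>0 \<le> 2 / D * a\<close> by simp
      next
        assume "X / 8 \<le> offline_volume k u"
        then have "(X / 8)\<^sup>2 \<le> (offline_volume k u)\<^sup>2"
          using X_nonneg by (intro power_mono) auto
        also have "\<dots> \<le> 4 * b"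
          unfolding b_def by (intro square_offline_volume_le assms)
        finally have "X\<^sup>2 \<le> 256 * b" by (simp add: power2_eq_square)
        then show ?thesis
          unfolding X_def[symmetric] bound using nonneg \<open>0 \<le> 2 / D * a\<close> by simp
      qed
    qed
  qed
qed

section \<open>Summation over the density classes\<close>

abbreviation classes :: "int set" where
  "classes \<equiv> job_class ` jobs I"

text \<open>After exchanging the sums, each job counts in all classes up to its own, with geometric
  weights that add up to at most twice its density.\<close>

lemma sum_classes_le:
  assumes "A \<subseteq> jobs I" and "\<And>i. i \<in> A \<Longrightarrow> 0 \<le> f i"
  shows "(\<Sum>k\<in>classes. 2 powi k * (\<Sum>i | i \<in> A \<and> k \<le> job_class i. f i))
    \<le> 2 * (\<Sum>i\<in>A. density I i * f i)"
proof -
  have fin: "finite A" using assms(1) finite_jobs finite_subset by blast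
  have "(\<Sum>k\<in>classes. 2 powi k * (\<Sum>i | i \<in> A \<and> k \<le> job_class i. f i))
      = (\<Sum>k\<in>classes. \<Sum>i\<in>A. if k \<le> job_class i then 2 powi k * f i else 0)"
    using fin by (intro sum.cong refl) (simp add: sum_distrib_left sum.If_cases Int_def)
  also have "\<dots> = (\<Sum>i\<in>A. \<Sum>k\<in>classes. if k \<le> job_class i then 2 powi k * f i else 0)"
    by (rule sum.swap)
  also have "\<dots> \<le> (\<Sum>i\<in>A. 2 * (density I i * f i))"
  proof (intro sum_mono)
    fix i assume i: "i \<in> A"
    then have dens: "0 < density I i" using assms(1) density_pos by blast
    have "(\<Sum>k | k \<in> classes \<and> k \<le> job_class i. 2 powi k) \<le> 2 * density I i"
    proof (intro sum_powi_le)
      fix k assume "k \<in> {k. k \<in> classes \<and> k \<le> job_class i}"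
      then have "2 powi k \<le> (2 powi job_class i :: real)" by (intro power_int_increasing) auto
      then show "2 powi k \<le> density I i" using floor2_le[OF dens] by simp
    qed (use dens in auto)
    then have "(\<Sum>k | k \<in> classes \<and> k \<le> job_class i. 2 powi k) * f i \<le> 2 * density I i * f i"
      using assms(2)[OF i] by (rule mult_right_mono)
    then show "(\<Sum>k\<in>classes. if k \<le> job_class i then 2 powi k * f i else 0) \<le> 2 * (density I i * f i)"
      by (simp add: sum.If_cases Int_def sum_distrib_right mult.assoc)
  qed
  finally show ?thesis by (simp add: sum_distrib_left)
qed

lemma sum_classes_volume_le:
  "(\<Sum>k\<in>classes. 2 powi k * (\<Sum>t<T. volume k t)) \<le> 2 * flow"
proof -
  have "(\<Sum>k\<in>classes. 2 powi k * (\<Sum>t<T. volume k t))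
      = (\<Sum>t<T. \<Sum>k\<in>classes. 2 powi k * volume k t)"
    unfolding sum_distrib_left by (rule sum.swap)
  also have "\<dots> \<le> (\<Sum>t<T. 2 * pending_weight t)"
    unfolding volume_def pending_weight_def
    by (intro sum_mono sum_classes_le pending_nonneg) auto
  finally show ?thesis by (simp add: sum_distrib_left)
qed

lemma sum_classes_offline_volume_le:
  "(\<Sum>k\<in>classes. 2 powi k * (\<Sum>t<T. offline_volume k t)) \<le> 2 * offline_cost"
proof -
  have "(\<Sum>k\<in>classes. 2 powi k * (\<Sum>t<T. offline_volume k t))
      = (\<Sum>t<T. \<Sum>k\<in>classes. 2 powi k * offline_volume k t)"
    unfolding sum_distrib_left by (rule sum.swap)
  also have "\<dots> \<le> (\<Sum>t<T. 2 * (\<Sum>i | i \<in> jobs I \<and> release I i \<le> t. density I i * left i t))"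
  proof (intro sum_mono)
    fix t
    show "(\<Sum>k\<in>classes. 2 powi k * offline_volume k t)
      \<le> 2 * (\<Sum>i | i \<in> jobs I \<and> release I i \<le> t. density I i * left i t)"
      using sum_classes_le[of "{i. i \<in> jobs I \<and> release I i \<le> t}" "\<lambda>i. left i t"] left_nonneg
      by (simp add: offline_volume_def conj_assoc)
  qed
  also have "\<dots> = 2 * (\<Sum>t<T. \<Sum>i\<in>jobs I. if release I i \<le> t then density I i * left i t else 0)"
    by (simp add: sum_distrib_left sum.If_cases Int_def)
  also have "\<dots> = 2 * (\<Sum>i\<in>jobs I. \<Sum>t<T. if release I i \<le> t then density I i * left i t else 0)"
    by (subst sum.swap) (rule refl)
  also have "\<dots> = 2 * offline_cost"
  proof -
    have "{..<T} \<inter> {t. release I i \<le> t} = {release I i..<T}" for i by auto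
    then show ?thesis by (simp add: offline_cost_def sum.If_cases)
  qed
  finally show ?thesis .
qed

text \<open>If a slot is locked for \<open>k\<close>, all jobs of class at least \<open>k\<close>
  are denser than the running one, so their volume is part of the excess.\<close>

lemma sum_classes_locked_le:
  "(\<Sum>k\<in>classes. 2 powi k * (\<Sum>t<T. of_bool (locked k t) * volume k t)) \<le> 2 * (\<Sum>t<T. excess t)"
proof -
  have "(\<Sum>k\<in>classes. 2 powi k * (\<Sum>t<T. of_bool (locked k t) * volume k t))
      = (\<Sum>t<T. \<Sum>k\<in>classes. 2 powi k * (of_bool (locked k t) * volume k t))"
    unfolding sum_distrib_left by (rule sum.swap)
  also have "\<dots> \<le> (\<Sum>t<T. 2 * excess t)"
  proof (intro sum_mono)
    fix t
    show "(\<Sum>k\<in>classes. 2 powi k * (of_bool (locked k t) * volume k t)) \<le> 2 * excess t"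
    proof (cases "S t")
      case None
      then show ?thesis by (simp add: locked_def excess_def)
    next
      case (Some j)
      then have j: "j \<in> jobs I" using scheduled_accepted by blast
      let ?A = "{i. i \<in> accepted \<and> density I j < density I i}"
      have "of_bool (locked k t) * volume k t \<le> (\<Sum>i | i \<in> ?A \<and> k \<le> job_class i. pending i t)" for k
      proof (cases "locked k t")
        case True
        then have k: "job_class j < k" using Some by (simp add: locked_def)
        have "volume k t \<le> (\<Sum>i | i \<in> ?A \<and> k \<le> job_class i. pending i t)"
          unfolding volume_def
        proof (intro sum_mono2 pending_nonneg subsetI)
          fix i assume i: "i \<in> {i. i \<in> accepted \<and> k \<le> job_class i}"
          then have "\<not> density I i \<le> density I j"
            using floor2_mono[of "density I i" "density I j"] density_pos[of i] k by auto
          then show "i \<in> {i. i \<in> ?A \<and> k \<le> job_class i}" using i by auto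
        qed simp
        then show ?thesis using True by simp
      next
        case False
        then show ?thesis by (simp add: sum_nonneg pending_nonneg)
      qed
      then have "(\<Sum>k\<in>classes. 2 powi k * (of_bool (locked k t) * volume k t))
          \<le> (\<Sum>k\<in>classes. 2 powi k * (\<Sum>i | i \<in> ?A \<and> k \<le> job_class i. pending i t))"
        by (intro sum_mono mult_left_mono) auto
      also have "\<dots> \<le> 2 * (\<Sum>i\<in>?A. density I i * pending i t)"
        by (intro sum_classes_le pending_nonneg) auto
      finally show ?thesis using Some by (simp add: excess_def)
    qed
  qed
  finally show ?thesis by (simp add: sum_distrib_left)
qed

lemma sum_square_bound_le:
  assumes "0 < D"
  shows "(\<Sum>k\<in>classes. 2 powi k * square_bound D k)
    \<le> 4 / D * flow + 512 * offline_cost + 32 * total_cost / \<epsilon>"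
proof -
  have "(\<Sum>k\<in>classes. 2 powi k * square_bound D k)
      = 2 / D * (\<Sum>k\<in>classes. 2 powi k * (\<Sum>t<T. volume k t))
        + 256 * (\<Sum>k\<in>classes. 2 powi k * (\<Sum>t<T. offline_volume k t))
        + 16 * (\<Sum>k\<in>classes. 2 powi k * (\<Sum>t<T. of_bool (locked k t) * volume k t))"
    unfolding square_bound_def sum_distrib_left[of _ _ classes] sum.distrib [symmetric]
    by (intro sum.cong refl) (simp only: distrib_left mult_ac)
  also have "\<dots> \<le> 2 / D * (2 * flow) + 256 * (2 * offline_cost) + 16 * (2 * (total_cost / \<epsilon>))"
    using assms sum_classes_volume_le sum_classes_offline_volume_le
      order_trans[OF sum_classes_locked_le mult_left_mono[OF sum_excess_le]]
    by (intro add_mono mult_left_mono) auto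
  finally show ?thesis by simp
qed

section \<open>The jobs left over in the second table\<close>

text \<open>Meant to bound the weight pending in the classes below \<open>k\<close>: densities in
  class \<open>i\<close> are below \<open>2 * 2 powi i\<close>, and volumes are at most the square
  root. Being independent of time, it serves all jobs of class \<open>k\<close> at once.\<close>

definition lower_weight_bound :: "real \<Rightarrow> int \<Rightarrow> real" where
  "lower_weight_bound D k = 2 * (\<Sum>i | i \<in> classes \<and> i < k. 2 powi i * sqrt (square_bound D i))"

lemma sum_D_minus_le:
  assumes "0 < D" and "(speed - 1) * D \<le> 1 / 4" and "1 \<le> speed" and j: "j \<in> jobs I"
  shows "(\<Sum>i\<in>D_minus I S R j. remaining_weight I S i (release I j))
    \<le> lower_weight_bound D (job_class j)"
proof -
  let ?r = "release I j" and ?K = "{k. k \<in> classes \<and> k < job_class j}" and ?M = "D_minus I S R j"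
  have M: "i \<in> accepted \<and> release I i \<le> ?r \<and> job_class i \<in> ?K" if "i \<in> ?M" for i
    using that by (auto simp: D_minus_def D_plus_def active_at_arrival_def active_def)
  then have fin: "finite ?M"
    by (intro finite_subset[OF _ finite_jobs]) auto
  have "(\<Sum>i\<in>?M. remaining_weight I S i ?r)
      = (\<Sum>k\<in>?K. \<Sum>i | i \<in> ?M \<and> job_class i = k. remaining_weight I S i ?r)"
    using fin M by (intro sum.group[symmetric]) auto
  also have "\<dots> \<le> (\<Sum>k\<in>?K. 2 * (2 powi k * sqrt (square_bound D k)))"
  proof (intro sum_mono)
    fix k
    let ?X = "{i. i \<in> ?M \<and> job_class i = k}"
    have "(\<Sum>i\<in>?X. remaining_weight I S i ?r) \<le> (\<Sum>i\<in>?X. 2 * 2 powi k * pending i ?r)"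
    proof (intro sum_mono)
      fix i assume i: "i \<in> ?X"
      then have "density I i \<le> 2 * 2 powi k"
        using M[of i] less_floor2[OF density_pos, of i] by auto
      then show "remaining_weight I S i ?r \<le> 2 * 2 powi k * pending i ?r"
        using i M[of i] unfolding remaining_weight_def pending_def
        by (auto intro: mult_right_mono remaining_nonneg)
    qed
    also have "\<dots> = 2 * 2 powi k * (\<Sum>i\<in>?X. pending i ?r)" by (simp add: sum_distrib_left)
    also have "\<dots> \<le> 2 * 2 powi k * volume k ?r"
      unfolding volume_def using M
      by (intro mult_left_mono sum_mono2 pending_nonneg) auto
    also have "\<dots> \<le> 2 * 2 powi k * sqrt (square_bound D k)"
      by (intro mult_left_mono real_le_rsqrt square_volume_le assms release_less_end) auto
    finally show "(\<Sum>i\<in>?X. remaining_weight I S i ?r) \<le> 2 * (2 powi k * sqrt (square_bound D k))"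
      by simp
  qed
  finally show ?thesis by (simp add: lower_weight_bound_def sum_distrib_left)
qed

text \<open>Write \<open>G\<close> for the weight bound of class \<open>k\<close>. An assigned job
  has \<alpha> at most \<open>p * G\<close>, while assignment forces
  \<open>w < \<epsilon> * G\<close> and so limits \<open>p\<close>. Both indices are thus bounded,
  and the geometric sums apply. The factor \<epsilon> gained here cancels the
  \<open>1 / \<epsilon>\<close> in front of the bucket sum.\<close>

lemma sum_buckets_minus_le:
  assumes "0 < D" and "(speed - 1) * D \<le> 1 / 4" and "1 \<le> speed"
  shows "(\<Sum>b\<in>buckets_minus. 2 powi fst b)
    \<le> 8 * \<epsilon> * (\<Sum>k\<in>classes. (lower_weight_bound D k)\<^sup>2 / 2 powi k)"
proof -
  let ?G = "lower_weight_bound D"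
  have fin: "finite buckets_minus" by (simp add: buckets_minus_def)
  have G_nonneg: "0 \<le> ?G k" for k
    unfolding lower_weight_bound_def using assms(1)
    by (intro mult_nonneg_nonneg sum_nonneg) (auto simp: square_bound_nonneg)
  have bounds: "2 powi i \<le> 2 * ?G k * 2 powi l \<and> 2 powi l \<le> \<epsilon> * ?G k / 2 powi k"
    if mem: "(i, k, l) \<in> buckets_minus" for i k l
  proof -
    obtain j where j: "j \<in> jobs I" and assigned: "assigned_minus I \<epsilon> S R j"
      and i: "i = floor2 (alpha_minus I S R j)" and k: "k = job_class j"
      and l: "l = floor2 (real (ptime I j))"
      using mem by (auto simp: buckets_minus_def bucket_minus_def)
    define W where "W = (\<Sum>i\<in>D_minus I S R j. remaining_weight I S i (release I j))"
    have \<alpha>: "alpha_minus I S R j = real (ptime I j) * W"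
      by (simp add: alpha_minus_def W_def)
    have W: "W \<le> ?G k" unfolding W_def k using assms j by (rule sum_D_minus_le)
    have p: "0 < real (ptime I j)" using ptime_pos[OF j] by simp
    have "2 powi i \<le> real (ptime I j) * W"
      unfolding i \<alpha>[symmetric] using alpha_minus_pos[OF j assigned] by (rule floor2_le)
    also have "\<dots> \<le> (2 * 2 powi l) * ?G k"
      unfolding l using less_floor2[OF p] W G_nonneg p
      by (intro order_trans[OF mult_left_mono mult_right_mono]) auto
    finally have 1: "2 powi i \<le> 2 * ?G k * 2 powi l" by (simp add: mult_ac)
    have "real (ptime I j) * (weight I j / \<epsilon>) < real (ptime I j) * W"
      using assigned by (simp add: assigned_minus_def \<alpha> mult.commute)
    then have "weight I j / \<epsilon> < W" using p by (simp only: mult_less_cancel_left_pos)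
    then have "weight I j \<le> \<epsilon> * W" using eps_pos by (simp add: field_simps)
    moreover have "2 powi k * 2 powi l \<le> density I j * real (ptime I j)"
      unfolding k l using p density_pos[OF j] by (intro mult_mono floor2_le) auto
    moreover have "\<epsilon> * W \<le> \<epsilon> * ?G k" using W eps_pos by (intro mult_left_mono) auto
    ultimately have "2 powi k * 2 powi l \<le> \<epsilon> * ?G k"
      using density_times_ptime[OF j] by linarith
    then have "2 powi l \<le> \<epsilon> * ?G k / 2 powi k"
      by (simp add: pos_le_divide_eq mult.commute)
    with 1 show ?thesis by simp
  qed
  have "(\<Sum>b\<in>buckets_minus. 2 powi fst b :: real)
      = (\<Sum>k\<in>classes. \<Sum>b | b \<in> buckets_minus \<and> fst (snd b) = k. 2 powi fst b)"
    using fin by (intro sum.group[symmetric]) (auto simp: buckets_minus_def bucket_minus_def)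
  also have "\<dots> \<le> (\<Sum>k\<in>classes. 4 * (2 * ?G k) * (\<epsilon> * ?G k / 2 powi k))"
  proof (intro sum_mono)
    fix k
    let ?B = "{b. b \<in> buckets_minus \<and> fst (snd b) = k}"
    let ?f = "\<lambda>b :: int \<times> int \<times> int. (fst b, snd (snd b))"
    have "(\<Sum>b\<in>?B. 2 powi fst b :: real) = (\<Sum>b\<in>?f ` ?B. 2 powi fst b)"
      by (subst sum.reindex) (auto simp: inj_on_def)
    also have "\<dots> \<le> 4 * (2 * ?G k) * (\<epsilon> * ?G k / 2 powi k)"
      using fin bounds G_nonneg eps_pos by (intro sum_powi_pairs_le) force+
    finally show "(\<Sum>b\<in>?B. 2 powi fst b) \<le> 4 * (2 * ?G k) * (\<epsilon> * ?G k / 2 powi k)" .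
  qed
  also have "\<dots> = 8 * \<epsilon> * (\<Sum>k\<in>classes. (?G k)\<^sup>2 / 2 powi k)"
    by (simp add: sum_distrib_left power2_eq_square mult_ac)
  finally show ?thesis .
qed

lemma sum_lower_weight_bound_le:
  assumes "0 < D"
  shows "(\<Sum>k\<in>classes. (lower_weight_bound D k)\<^sup>2 / 2 powi k)
    \<le> 24 * (\<Sum>k\<in>classes. 2 powi k * square_bound D k)"
proof -
  let ?x = "\<lambda>k. sqrt (square_bound D k)"
  have "(\<Sum>k\<in>classes. (lower_weight_bound D k)\<^sup>2 / 2 powi k)
      = 4 * (\<Sum>k\<in>classes. (\<Sum>i | i \<in> classes \<and> i < k. 2 powi i * ?x i)\<^sup>2 / 2 powi k)"
    unfolding lower_weight_bound_def power_mult_distrib sum_distrib_left[of 4 _ classes]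
    by (intro sum.cong refl) simp
  also have "\<dots> \<le> 4 * (6 * (\<Sum>k\<in>classes. 2 powi k * (?x k)\<^sup>2))"
    by (intro mult_left_mono sum_square_prefix_le) auto
  finally show ?thesis using square_bound_nonneg[OF assms] by simp
qed

section \<open>Combining the estimates\<close>

lemma flow_le:
  assumes "1 \<le> speed" and "speed - 1 \<le> \<epsilon> / 24576"
  shows "flow \<le> 491624 / \<epsilon>\<^sup>2 * offline_cost"
proof -
  \<comment> \<open>Chosen so that \<open>384 * 4 / D = 1 / 4\<close>: the leftover jobs then cost
    at most a quarter of the flow-time. The speed margin \<open>1 / 24576\<close> is
    \<open>1 / (4 * D)\<close>.\<close>
  define D :: real where "D = 6144"
  define z where "z = 1 / \<epsilon>"
  have z: "1 \<le> z" using one_le_eps_inverse by (simp add: z_def)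
  have eps_le: "\<epsilon> \<le> 1" using one_le_eps_inverse eps_pos by (simp add: field_simps)
  have D: "0 < D" "(speed - 1) * D \<le> 1 / 4" using assms eps_le by (auto simp: D_def)
  define acc where "acc = (\<Sum>j\<in>accepted. increase j)"
  define rej where "rej = (\<Sum>j\<in>R. increase j)"
  define rest where "rest = 2 / \<epsilon> * (\<Sum>b\<in>buckets_minus. 2 powi fst b :: real)"
  have R_le: "(\<Sum>j\<in>R. alpha_minus I S R j) \<ge> 0"
    by (intro sum_nonneg alpha_minus_nonneg)
  have increases: "(\<Sum>j\<in>jobs I. increase j) = acc + rej"
    unfolding acc_def rej_def by (rule sum.subset_diff) (auto simp: rejected_subset[THEN subsetD])
  have 1: "flow \<le> acc + total_cost + total_cost * z"
    using flow_le_increases[of T] by (simp add: acc_def z_def)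
  have 2: "acc + rej \<le> offline_cost + speed * flow"
    using increases_le increases by simp
  have 3: "acc + rej \<le> 2 * total_cost * z + 4 * z * rej + rest"
  proof -
    have "(\<Sum>j\<in>jobs I. increase j)
        = (\<Sum>j\<in>jobs I. alpha_plus I S R j) + (\<Sum>j\<in>jobs I. alpha_minus I S R j)"
      by (simp add: increase_def sum.distrib)
    moreover have "rej = (\<Sum>j\<in>R. alpha_plus I S R j) + (\<Sum>j\<in>R. alpha_minus I S R j)"
      by (simp add: rej_def increase_def sum.distrib)
    moreover have "2 / \<epsilon> * (\<Sum>j\<in>R. alpha_minus I S R j) \<le> 4 / \<epsilon> * (\<Sum>j\<in>R. alpha_minus I S R j)"
      using R_le eps_pos by (intro mult_right_mono divide_right_mono) auto
    ultimately show ?thesis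
      using sum_alpha_plus_le sum_alpha_minus_le increases
      by (simp add: rest_def z_def distrib_left)
  qed
  have 4: "rest \<le> flow / 4 + 196608 * offline_cost + 12288 * total_cost * z"
  proof -
    have "rest \<le> 2 / \<epsilon> * (8 * \<epsilon> * (24 * (\<Sum>k\<in>classes. 2 powi k * square_bound D k)))"
      unfolding rest_def
      using sum_buckets_minus_le[OF D assms(1)] sum_lower_weight_bound_le[OF D(1)] eps_pos
      by (intro mult_left_mono order_trans[OF sum_buckets_minus_le[OF D assms(1)] mult_left_mono]) auto
    also have "\<dots> = 384 * (\<Sum>k\<in>classes. 2 powi k * square_bound D k)"
      using eps_pos by simp
    also have "\<dots> \<le> 384 * (4 / D * flow + 512 * offline_cost + 32 * total_cost / \<epsilon>)"
      by (intro mult_left_mono sum_square_bound_le D) simp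
    finally show ?thesis by (simp add: D_def z_def)
  qed
  have total: "total_cost \<le> 4 * offline_cost" by (rule total_cost_le)
  have total_nonneg: "0 \<le> total_cost"
    using weight_pos by (intro sum_nonneg mult_nonneg_nonneg) (auto intro: less_imp_le)
  then have cost_nonneg: "0 \<le> offline_cost" using total by linarith
  have flow_nonneg: "0 \<le> flow" by (intro sum_nonneg pending_weight_nonneg)
  \<comment> \<open>Together 1 and 2 cancel the flow-time up to a \<open>speed - 1\<close> share,
    small enough to be multiplied by \<open>4 * z\<close>.\<close>
  have "rej \<le> offline_cost + (speed - 1) * flow + total_cost + total_cost * z"
    using 1 2 by (simp add: left_diff_distrib)
  then have "4 * z * rej \<le> 4 * z * (offline_cost + (speed - 1) * flow + total_cost + total_cost * z)"
    using z by (intro mult_left_mono) auto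
  also have "\<dots> = 4 * (offline_cost * z) + 4 * (z * (speed - 1)) * flow + 4 * (total_cost * z) + 4 * (total_cost * z * z)"
    by (simp add: algebra_simps)
  also have "4 * (z * (speed - 1)) * flow \<le> 1 / 4 * flow"
  proof (intro mult_right_mono flow_nonneg)
    have "z * (speed - 1) \<le> z * (\<epsilon> / 24576)" using z assms(2) by (intro mult_left_mono) auto
    then show "4 * (z * (speed - 1)) \<le> 1 / 4" using eps_pos by (simp add: z_def)
  qed
  finally have rej: "4 * z * rej \<le> 4 * (offline_cost * z) + flow / 4 + 4 * (total_cost * z) + 4 * (total_cost * z * z)"
    by simp
  have rej_nonneg: "0 \<le> rej"
    unfolding rej_def increase_def using rejected_subset
    by (intro sum_nonneg add_nonneg_nonneg alpha_plus_nonneg alpha_minus_nonneg) auto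
  have tz: "total_cost * z \<le> 4 * (offline_cost * z)"
    using mult_right_mono[OF total, of z] z by simp
  have tzz: "total_cost * z * z \<le> 4 * (offline_cost * z * z)"
    using mult_right_mono[OF tz, of z] z by simp
  have oz: "offline_cost \<le> offline_cost * z"
    using mult_left_mono[OF z cost_nonneg] by simp
  have ozz: "offline_cost * z \<le> offline_cost * z * z"
    using mult_left_mono[OF z, of "offline_cost * z"] cost_nonneg z by simp
  \<comment> \<open>\<open>rej\<close> and \<open>rest\<close> each bring in
    \<open>flow / 4\<close>, which leaves half of the flow-time on the left. The other terms amount
    to 245812 times \<open>offline_cost * z * z\<close>; the second \<open>z\<close> stems from
    \<open>total_cost * z\<close> within the bound on \<open>rej\<close>.\<close>
  have "flow \<le> 491624 * (offline_cost * z * z)"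
    using 1 3 4 rej rej_nonneg total tz tzz oz ozz by linarith
  then show ?thesis by (simp add: z_def power2_eq_square)
qed

end

section \<open>Offline schedules\<close>

lemma offline_slot_lmeasurable:
  assumes "offline_schedule I speed \<sigma>" and "j \<in> jobs I"
  shows "{u. a \<le> u \<and> u \<le> b \<and> \<sigma> u = Some j} \<in> lmeasurable"
proof -
  have "{a..b} \<inter> {u. \<sigma> u = Some j} \<in> lmeasurable"
    using assms by (intro fmeasurable_Int_fmeasurable) (auto simp: offline_schedule_def)
  then show ?thesis by (rule back_subst) auto
qed

lemma offline_remaining_diff:
  assumes "offline_schedule I speed \<sigma>" and "j \<in> jobs I" and "a \<le> b"
  shows "offline_remaining I speed \<sigma> j a - offline_remaining I speed \<sigma> j b
    = speed * measure lebesgue ({a<..b} \<inter> {u. \<sigma> u = Some j})"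
proof -
  let ?r = "real (release I j)"
  let ?E = "\<lambda>t. {u. ?r \<le> u \<and> u \<le> t \<and> \<sigma> u = Some j}"
  let ?N = "{a<..b} \<inter> {u. \<sigma> u = Some j}"
  have released: "?r \<le> u" if "\<sigma> u = Some j" for u
    using assms(1) that by (auto simp: offline_schedule_def)
  have E: "?E t \<in> lmeasurable" for t using assms(1,2) by (rule offline_slot_lmeasurable)
  have "?E b - ?E a \<in> lmeasurable" using E by (intro fmeasurable_Diff fmeasurableD)
  moreover have N: "?E b - ?E a = ?N" using released assms(3) by force
  ultimately have N': "?N \<in> lmeasurable" by simp
  have "?E b = ?E a \<union> ?N" using released assms(3) by force
  moreover have "measure lebesgue (?E a \<union> ?N) = measure lebesgue (?E a) + measure lebesgue ?N"
    using fmeasurableD2[OF E] fmeasurableD2[OF N'] fmeasurableD[OF E] fmeasurableD[OF N']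
    by (intro measure_Union) auto
  ultimately show ?thesis by (simp add: offline_remaining_def algebra_simps)
qed

text \<open>At each instant at most one job runs, so the times given to different jobs are disjoint
  parts of a slot of measure 1.\<close>

lemma sum_offline_remaining_diff_le:
  assumes "offline_schedule I speed \<sigma>" and "finite (jobs I)" and "0 \<le> speed"
  shows "(\<Sum>j\<in>jobs I. offline_remaining I speed \<sigma> j (real t) - offline_remaining I speed \<sigma> j (real (Suc t)))
    \<le> speed"
proof -
  let ?N = "\<lambda>j. {real t<..real (Suc t)} \<inter> {u. \<sigma> u = Some j}"
  have slot: "{real t<..real (Suc t)} \<in> lmeasurable"
    by (intro bounded_set_imp_lmeasurable bounded_subset[OF bounded_closed_interval[of "real t" "real (Suc t)"]]) auto
  have N: "?N j \<in> lmeasurable" if "j \<in> jobs I" for j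
    using assms(1) that slot
    by (intro fmeasurable_Int_fmeasurable) (auto simp: offline_schedule_def)
  have "(\<Sum>j\<in>jobs I. measure lebesgue (?N j)) = measure lebesgue (\<Union>j\<in>jobs I. ?N j)"
  proof (rule measure_finite_Union[symmetric])
    show "?N ` jobs I \<subseteq> sets lebesgue" using N fmeasurableD by blast
    show "disjoint_family_on ?N (jobs I)" by (auto simp: disjoint_family_on_def)
    show "emeasure lebesgue (?N j) \<noteq> \<infinity>" if "j \<in> jobs I" for j
      unfolding infinity_ennreal_def using N[OF that] by (rule fmeasurableD2)
  qed (rule assms)
  also have "\<dots> \<le> measure lebesgue {real t<..real (Suc t)}"
    using N assms(2) slot by (intro measure_mono_fmeasurable sets.finite_UN fmeasurableD) auto
  finally have "(\<Sum>j\<in>jobs I. measure lebesgue (?N j)) \<le> 1" by simp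
  then have "speed * (\<Sum>j\<in>jobs I. measure lebesgue (?N j)) \<le> speed * 1"
    using assms(3) by (rule mult_left_mono)
  then show ?thesis
    using offline_remaining_diff[OF assms(1), of _ "real t" "real (Suc t)"]
    by (simp add: sum_distrib_left)
qed

lemma offline_remaining_before_release:
  assumes "t \<le> real (release I j)"
  shows "offline_remaining I speed \<sigma> j t = real (ptime I j)"
proof -
  have "{u. real (release I j) \<le> u \<and> u \<le> t \<and> \<sigma> u = Some j} \<subseteq> {t}" using assms by auto
  then have "measure lebesgue {u. real (release I j) \<le> u \<and> u \<le> t \<and> \<sigma> u = Some j} = 0"
    using negligible_sing negligible_subset negligible_imp_measure0 by blast
  then show ?thesis by (simp add: offline_remaining_def)
qed

lemma offline_horizon:
  assumes "offline_schedule I speed \<sigma>" and "finite (jobs I)" and "0 \<le> speed"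
  obtains T\<^sub>0 :: nat where "\<And>T j. T\<^sub>0 \<le> T \<Longrightarrow> j \<in> jobs I \<Longrightarrow> offline_remaining I speed \<sigma> j (real T) = 0"
proof -
  have "\<forall>j\<in>jobs I. \<exists>t. offline_remaining I speed \<sigma> j t = 0"
    using assms(1) by (auto simp: offline_schedule_def)
  then obtain \<tau> where \<tau>: "\<And>j. j \<in> jobs I \<Longrightarrow> offline_remaining I speed \<sigma> j (\<tau> j) = 0" by metis
  \<comment> \<open>Without jobs this \<open>Max\<close> is unspecified, but then there is nothing
    to show.\<close>
  define T\<^sub>0 where "T\<^sub>0 = Max ((\<lambda>j. nat \<lceil>\<tau> j\<rceil>) ` jobs I)"
  show thesis
  proof
    fix T j assume "T\<^sub>0 \<le> T" and j: "j \<in> jobs I"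
    moreover have "nat \<lceil>\<tau> j\<rceil> \<le> T\<^sub>0" unfolding T\<^sub>0_def using assms(2) j by (intro Max_ge) auto
    ultimately have le: "\<tau> j \<le> real T" by linarith
    have "0 \<le> speed * measure lebesgue ({\<tau> j<..real T} \<inter> {u. \<sigma> u = Some j})"
      using assms(3) by simp
    then have "offline_remaining I speed \<sigma> j (real T) \<le> 0"
      using offline_remaining_diff[OF assms(1) j le] \<tau>[OF j] by linarith
    moreover have "0 \<le> offline_remaining I speed \<sigma> j (real T)"
      using assms(1) j by (auto simp: offline_schedule_def)
    ultimately show "offline_remaining I speed \<sigma> j (real T) = 0" by simp
  qed
qed

context rejection_run
begin

lemma offline_comparison:
  assumes "offline_schedule I speed \<sigma>" and "1 \<le> speed" and "speed \<le> 2"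
    and "\<And>j. j \<in> jobs I \<Longrightarrow> offline_remaining I speed \<sigma> j (real T) = 0"
  shows "rejection_run_comparison I \<epsilon> S R (\<lambda>j t. offline_remaining I speed \<sigma> j (real t)) speed T"
proof unfold_locales
  fix j t assume j: "j \<in> jobs I"
  show "0 \<le> offline_remaining I speed \<sigma> j (real t)"
    using assms(1) j by (auto simp: offline_schedule_def)
  show "offline_remaining I speed \<sigma> j (real t) = real (ptime I j)" if "t \<le> release I j"
    using that by (intro offline_remaining_before_release) simp
  have "0 \<le> speed * measure lebesgue ({real t<..real (Suc t)} \<inter> {u. \<sigma> u = Some j})"
    using assms(2) by simp
  then show "offline_remaining I speed \<sigma> j (real (Suc t)) \<le> offline_remaining I speed \<sigma> j (real t)"
    using offline_remaining_diff[OF assms(1) j, of "real t" "real (Suc t)"] by simp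
next
  fix t
  show "(\<Sum>j\<in>jobs I. offline_remaining I speed \<sigma> j (real t)
      - offline_remaining I speed \<sigma> j (real (Suc t))) \<le> speed"
    using assms by (intro sum_offline_remaining_diff_le) auto
qed (use assms in auto)

lemma offline_frac_flow_time_ge:
  assumes "offline_schedule I speed \<sigma>"
  shows "ennreal (\<Sum>j\<in>jobs I. \<Sum>t=release I j..<T. density I j * offline_remaining I speed \<sigma> j (real t))
    \<le> offline_frac_flow_time I speed \<sigma>"
proof -
  let ?f = "\<lambda>j t. density I j * offline_remaining I speed \<sigma> j (real t)"
  have nonneg: "0 \<le> ?f j t" if "j \<in> jobs I" for j t
    using assms density_pos[OF that] that by (auto simp: offline_schedule_def)
  have "ennreal (\<Sum>j\<in>jobs I. \<Sum>t=release I j..<T. ?f j t)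
      = (\<Sum>j\<in>jobs I. \<Sum>t=release I j..<T. ennreal (?f j t))"
    using nonneg by (simp add: sum_nonneg flip: sum_ennreal)
  also have "\<dots> \<le> offline_frac_flow_time I speed \<sigma>"
    unfolding offline_frac_flow_time_def frac_flow_time_def
  proof (intro sum_mono)
    fix j
    have "(\<Sum>t=release I j..<T. ennreal (?f j t))
        = (\<Sum>k<T - release I j. ennreal (?f j (release I j + k)))"
      by (rule sum.reindex_bij_witness[of _ "\<lambda>k. release I j + k" "\<lambda>t. t - release I j"]) auto
    also have "\<dots> \<le> (\<Sum>k. ennreal (?f j (release I j + k)))"
      by (intro sum_le_suminf) auto
    finally show "(\<Sum>t=release I j..<T. ennreal (?f j t)) \<le> (\<Sum>k. ennreal (?f j (release I j + k)))" .
  qed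
  finally show ?thesis .
qed

section \<open>From the cut-off sums to the costs of \<A> and \<B>\<close>

text \<open>The ends vary with the job so as to serve both algorithms: a common length after the
  release for \<A>, the start times for \<B>.\<close>

lemma sum_density_remaining_le:
  assumes "A \<subseteq> accepted" and "\<And>j. j \<in> A \<Longrightarrow> e j \<le> T"
  shows "(\<Sum>j\<in>A. \<Sum>t=release I j..<e j. density I j * rem j t) \<le> (\<Sum>t<T. pending_weight t)"
proof -
  have "(\<Sum>j\<in>A. \<Sum>t=release I j..<e j. density I j * rem j t)
      = (\<Sum>j\<in>A. \<Sum>t=release I j..<e j. density I j * pending j t)"
    by (intro sum.cong) (auto simp: pending_def)
  also have "\<dots> \<le> (\<Sum>j\<in>A. \<Sum>t<T. density I j * pending j t)"
    using assms
    by (intro sum_mono sum_mono2 mult_nonneg_nonneg pending_nonneg)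
       (fastforce intro: less_imp_le density_pos)+
  also have "\<dots> \<le> (\<Sum>j\<in>accepted. \<Sum>t<T. density I j * pending j t)"
    using assms(1)
    by (intro sum_mono2 sum_nonneg mult_nonneg_nonneg pending_nonneg)
       (auto intro: less_imp_le density_pos)
  also have "\<dots> = (\<Sum>t<T. pending_weight t)"
    unfolding pending_weight_def by (rule sum.swap)
  finally show ?thesis .
qed

text \<open>The bound is uniform in the cut-off, and each partial sum of the series lies within some
  cut-off.\<close>

lemma A_frac_flow_time_le:
  assumes "\<And>T. T\<^sub>0 \<le> T \<Longrightarrow> (\<Sum>t<T. pending_weight t) \<le> C"
  shows "A_frac_flow_time I S R \<le> ennreal C"
proof -
  let ?f = "\<lambda>j k. density I j * rem j (release I j + k)"
  have nonneg: "0 \<le> ?f j k" if "j \<in> accepted" for j k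
    using density_pos[of j] that remaining_nonneg by simp
  have "A_frac_flow_time I S R = (\<Sum>k. \<Sum>j\<in>accepted. ennreal (?f j k))"
    unfolding A_frac_flow_time_def frac_flow_time_def by (rule suminf_sum[symmetric]) simp
  also have "\<dots> \<le> ennreal C"
  proof (intro suminf_le_const summableI)
    fix n
    define T where "T = max T\<^sub>0 (Max (release I ` jobs I) + n)"
    have "(\<Sum>k<n. \<Sum>j\<in>accepted. ennreal (?f j k)) = (\<Sum>k<n. ennreal (\<Sum>j\<in>accepted. ?f j k))"
      by (intro sum.cong refl sum_ennreal nonneg)
    also have "\<dots> = ennreal (\<Sum>k<n. \<Sum>j\<in>accepted. ?f j k)"
      by (intro sum_ennreal sum_nonneg nonneg)
    also have "(\<Sum>k<n. \<Sum>j\<in>accepted. ?f j k) = (\<Sum>j\<in>accepted. \<Sum>k<n. ?f j k)"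
      by (rule sum.swap)
    also have "\<dots> = (\<Sum>j\<in>accepted. \<Sum>t=release I j..<release I j + n. density I j * rem j t)"
    proof (rule sum.cong[OF refl])
      fix j
      show "(\<Sum>k<n. ?f j k) = (\<Sum>t=release I j..<release I j + n. density I j * rem j t)"
        by (rule sum.reindex_bij_witness[of _ "\<lambda>t. t - release I j" "\<lambda>k. release I j + k"]) auto
    qed
    also have "\<dots> \<le> (\<Sum>t<T. pending_weight t)"
    proof (rule sum_density_remaining_le)
      fix j assume "j \<in> accepted"
      then have "release I j \<le> Max (release I ` jobs I)" by (intro Max_ge) auto
      then show "release I j + n \<le> T" by (simp add: T_def)
    qed simp
    also have "\<dots> \<le> C" by (intro assms) (simp add: T_def)
    finally show "(\<Sum>k<n. \<Sum>j\<in>accepted. ennreal (?f j k)) \<le> ennreal C"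
      by (simp add: ennreal_leI)
  qed
  finally show ?thesis .
qed

text \<open>A job that never starts keeps its full weight pending, and the cut-off sums would grow
  without bound.\<close>

lemma accepted_started:
  assumes "\<And>T. T\<^sub>0 \<le> T \<Longrightarrow> (\<Sum>t<T. pending_weight t) \<le> C" and j: "j \<in> accepted"
  shows "\<exists>s. S s = Some j"
proof (rule ccontr)
  assume "\<not> (\<exists>s. S s = Some j)"
  then have rem: "rem j t = real (ptime I j)" for t by (simp add: remaining_def)
  have w: "0 < weight I j" using weight_pos j by simp
  define n where "n = nat \<lceil>C / weight I j\<rceil> + 1"
  define T where "T = T\<^sub>0 + release I j + n"
  have "(\<Sum>i\<in>{j}. \<Sum>t=release I i..<T. density I i * rem i t) \<le> (\<Sum>t<T. pending_weight t)"
    using j by (intro sum_density_remaining_le) auto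
  also have "\<dots> \<le> C" by (intro assms) (simp add: T_def)
  finally have "real (T - release I j) * weight I j \<le> C"
    using j by (simp add: rem density_times_ptime)
  moreover have "real n * weight I j \<le> real (T - release I j) * weight I j"
    using w by (intro mult_right_mono) (auto simp: T_def)
  moreover have "C / weight I j < real n" unfolding n_def by linarith
  then have "C < real n * weight I j" using w by (simp add: pos_divide_less_eq)
  ultimately show False by linarith
qed

text \<open>Outside L a job runs without interruption once started, and \<B> copies all of its
  slots.\<close>

lemma completion_time_B_le:
  assumes "S s = Some j" and never_L: "\<And>t. \<not> in_L I \<epsilon> S j t"
  shows "completion_time I (B_schedule I \<epsilon> S) j \<le> start_time S j + ptime I j"
proof -
  let ?s = "start_time S j"
  have start: "S ?s = Some j" unfolding start_time_def using assms(1) by (rule LeastI)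
  have "{u. u < ?s \<and> S u = Some j} = {}"
    using not_less_Least unfolding start_time_def by blast
  then have rem_start: "rem j ?s = real (ptime I j)" by (simp add: remaining_def)
  have run: "rem j (?s + m) = real (ptime I j) - real m \<and> (m < ptime I j \<longrightarrow> S (?s + m) = Some j)"
    if "m \<le> ptime I j" for m
    using that
  proof (induction m)
    case 0
    then show ?case using start rem_start by simp
  next
    case (Suc m)
    then have prev: "S (?s + m) = Some j" and "rem j (?s + m) = real (ptime I j) - real m" by auto
    then have rem: "rem j (?s + Suc m) = real (ptime I j) - real (Suc m)"
      by (simp add: remaining_Suc)
    have "S (?s + Suc m) = Some j" if "Suc m < ptime I j"
      using prev rem that never_L by (intro run_continue) (simp add: must_continue_def)
    with rem show ?case by blast
  qed
  have "B_schedule I \<epsilon> S t = Some j \<longleftrightarrow> S t = Some j" for t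
    using never_L[of t] by (auto simp: B_schedule_def split: option.splits)
  then have "remaining I (B_schedule I \<epsilon> S) j (?s + ptime I j) = rem j (?s + ptime I j)"
    by (simp add: remaining_def)
  also have "\<dots> = 0" using run[of "ptime I j"] by simp
  finally show ?thesis unfolding completion_time_def by (rule Least_le)
qed

text \<open>Until its start a job has its full weight, so waiting costs the same fractionally and
  integrally; the uninterrupted run adds at most \<open>w * p\<close>.\<close>

lemma B_flow_time_le:
  assumes "\<And>T. T\<^sub>0 \<le> T \<Longrightarrow> (\<Sum>t<T. pending_weight t) \<le> C"
  shows "B_flow_time I \<epsilon> S R \<le> C + total_cost"
proof -
  let ?A = "jobs I - B_rejected I \<epsilon> S R" and ?s = "start_time S"
  have A: "?A \<subseteq> accepted" by (auto simp: B_rejected_def)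
  define T where "T = max T\<^sub>0 (Max (?s ` jobs I))"
  have "weight I j * (real (completion_time I (B_schedule I \<epsilon> S) j) - real (release I j))
      \<le> (\<Sum>t=release I j..<?s j. density I j * rem j t) + weight I j * real (ptime I j)"
    if j: "j \<in> ?A" for j
  proof -
    have "\<And>t. \<not> in_L I \<epsilon> S j t" using j by (auto simp: B_rejected_def)
    moreover obtain s where s: "S s = Some j" using accepted_started[OF assms] j A by blast
    ultimately have compl: "completion_time I (B_schedule I \<epsilon> S) j \<le> ?s j + ptime I j"
      by (intro completion_time_B_le)
    have "S (?s j) = Some j" unfolding start_time_def using s by (rule LeastI)
    then have released: "release I j \<le> ?s j" by (rule scheduled_released)
    have "rem j t = real (ptime I j)" if "t < ?s j" for t
    proof -
      have "{u. u < t \<and> S u = Some j} = {}"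
        using not_less_Least that unfolding start_time_def by (blast intro: less_trans)
      then show ?thesis by (simp add: remaining_def)
    qed
    then have "(\<Sum>t=release I j..<?s j. density I j * rem j t)
        = (\<Sum>t=release I j..<?s j. weight I j)"
      using j by (intro sum.cong) (auto simp: density_times_ptime)
    also have "\<dots> = weight I j * (real (?s j) - real (release I j))"
      using released by (simp add: of_nat_diff)
    finally have waiting: "(\<Sum>t=release I j..<?s j. density I j * rem j t)
        = weight I j * (real (?s j) - real (release I j))" .
    have "weight I j * (real (completion_time I (B_schedule I \<epsilon> S) j) - real (release I j))
        \<le> weight I j * (real (?s j) - real (release I j) + real (ptime I j))"
      using compl weight_pos[of j] j by (intro mult_left_mono) auto
    then show ?thesis unfolding waiting by (simp add: distrib_left)
  qed
  then have "B_flow_time I \<epsilon> S R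
      \<le> (\<Sum>j\<in>?A. (\<Sum>t=release I j..<?s j. density I j * rem j t) + weight I j * real (ptime I j))"
    unfolding B_flow_time_def by (intro sum_mono)
  also have "\<dots> = (\<Sum>j\<in>?A. \<Sum>t=release I j..<?s j. density I j * rem j t)
      + (\<Sum>j\<in>?A. weight I j * real (ptime I j))"
    by (rule sum.distrib)
  also have "(\<Sum>j\<in>?A. \<Sum>t=release I j..<?s j. density I j * rem j t) \<le> (\<Sum>t<T. pending_weight t)"
  proof (intro sum_density_remaining_le A)
    fix j assume "j \<in> ?A"
    then have "?s j \<le> Max (?s ` jobs I)" by (intro Max_ge) auto
    then show "?s j \<le> T" by (simp add: T_def)
  qed
  also have "(\<Sum>t<T. pending_weight t) \<le> C" by (intro assms) (simp add: T_def)
  also have "(\<Sum>j\<in>?A. weight I j * real (ptime I j)) \<le> total_cost"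
    using weight_pos by (intro sum_mono2 mult_nonneg_nonneg) (auto intro: less_imp_le)
  finally show ?thesis by simp
qed

text \<open>An infinite offline cost makes both claims trivial; otherwise \<open>flow_le\<close>
  applies at every cut-off past the offline horizon. The constant leaves room for the
  \<open>total_cost\<close> that \<B> adds.\<close>

lemma flow_times_le_offline:
  assumes "offline_schedule I speed \<sigma>" and "1 \<le> speed" and "speed - 1 \<le> \<epsilon> / 24576"
  shows "A_frac_flow_time I S R \<le> ennreal (500000 / \<epsilon>\<^sup>2) * offline_frac_flow_time I speed \<sigma>"
    and "ennreal (B_flow_time I \<epsilon> S R) \<le> ennreal (500000 / \<epsilon>\<^sup>2) * offline_frac_flow_time I speed \<sigma>"
proof -
  let ?off = "offline_frac_flow_time I speed \<sigma>"
  have "A_frac_flow_time I S R \<le> ennreal (500000 / \<epsilon>\<^sup>2) * ?off \<and>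
      ennreal (B_flow_time I \<epsilon> S R) \<le> ennreal (500000 / \<epsilon>\<^sup>2) * ?off"
  proof (cases "?off = top")
    case True
    then show ?thesis using eps_pos by (simp add: ennreal_mult_top)
  next
    case False
    define c where "c = enn2real ?off"
    have off: "?off = ennreal c" using False by (simp add: c_def less_top)
    have c_nonneg: "0 \<le> c" by (simp add: c_def)
    define z where "z = 1 / \<epsilon>\<^sup>2"
    have eps_le: "\<epsilon> \<le> 1" using one_le_eps_inverse eps_pos by (simp add: field_simps)
    then have z: "1 \<le> z" using eps_pos by (simp add: z_def power_le_one)
    have "0 \<le> speed" "speed \<le> 2" using assms(2,3) eps_le by auto
    obtain T\<^sub>0 where T\<^sub>0: "\<And>T j. T\<^sub>0 \<le> T \<Longrightarrow> j \<in> jobs I \<Longrightarrow> offline_remaining I speed \<sigma> j (real T) = 0"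
      using offline_horizon[OF assms(1) finite_jobs \<open>0 \<le> speed\<close>] by blast
    have bounds: "(\<Sum>t<T. pending_weight t) \<le> 491624 * z * c \<and> total_cost \<le> 4 * c"
      if "T\<^sub>0 \<le> T" for T
    proof -
      interpret rejection_run_comparison I \<epsilon> S R
          "\<lambda>j t. offline_remaining I speed \<sigma> j (real t)" speed T
        using assms(1,2) \<open>speed \<le> 2\<close> T\<^sub>0[OF that] by (rule offline_comparison)
      have "ennreal offline_cost \<le> ennreal c"
        unfolding offline_cost_def off[symmetric] using assms(1) by (rule offline_frac_flow_time_ge)
      then have cost: "offline_cost \<le> c" using c_nonneg by simp
      then have "491624 * z * offline_cost \<le> 491624 * z * c"
        using z by (intro mult_left_mono) auto
      then show ?thesis using flow_le[OF assms(2,3)] total_cost_le cost by (simp add: z_def)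
    qed
    have "c \<le> z * c" using mult_right_mono[OF z c_nonneg] by simp
    have "0 \<le> z * c" using z c_nonneg by simp
    have rhs: "ennreal (500000 / \<epsilon>\<^sup>2) * ?off = ennreal (500000 * z * c)"
      using c_nonneg unfolding off by (subst ennreal_mult[symmetric]) (simp_all add: z_def)
    have "A_frac_flow_time I S R \<le> ennreal (491624 * z * c)"
      using bounds by (intro A_frac_flow_time_le) auto
    also have "\<dots> \<le> ennreal (500000 * z * c)"
      using \<open>0 \<le> z * c\<close> by (intro ennreal_leI) linarith
    finally have A: "A_frac_flow_time I S R \<le> ennreal (500000 / \<epsilon>\<^sup>2) * ?off" by (simp add: rhs)
    have "B_flow_time I \<epsilon> S R \<le> 491624 * z * c + total_cost"
      using bounds by (intro B_flow_time_le) auto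
    also have "\<dots> \<le> 500000 * z * c"
      using bounds[OF order_refl] \<open>c \<le> z * c\<close> \<open>0 \<le> z * c\<close> by linarith
    finally have "ennreal (B_flow_time I \<epsilon> S R) \<le> ennreal (500000 / \<epsilon>\<^sup>2) * ?off"
      unfolding rhs by (rule ennreal_leI)
    with A show ?thesis ..
  qed
  then show "A_frac_flow_time I S R \<le> ennreal (500000 / \<epsilon>\<^sup>2) * ?off"
    and "ennreal (B_flow_time I \<epsilon> S R) \<le> ennreal (500000 / \<epsilon>\<^sup>2) * ?off" by auto
qed

end

theorem theorem5p2:
  shows "\<exists>c K :: real. 0 < c \<and> 0 < K \<and>
    (\<forall>(\<epsilon> :: real) (\<epsilon>' :: real) (I :: flow_instance) (S :: nat \<Rightarrow> nat option) (R :: nat set).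
       0 < \<epsilon> \<longrightarrow> \<epsilon>\<^sup>2 \<le> 1 / 2 \<longrightarrow> 1 / \<epsilon> \<in> \<int> \<longrightarrow>
       0 < \<epsilon>' \<longrightarrow> \<epsilon>' \<le> c * \<epsilon> \<longrightarrow>
       valid_instance I \<longrightarrow> A_run I \<epsilon> S R \<longrightarrow>
         A_frac_flow_time I S R
           \<le> ennreal (K / \<epsilon>\<^sup>2) * opt_frac_flow_time I (1 + \<epsilon>') \<and>
         ennreal (B_flow_time I \<epsilon> S R)
           \<le> ennreal (K / \<epsilon>\<^sup>2) * opt_frac_flow_time I (1 + \<epsilon>'))"
proof (rule exI[of _ "1 / 24576"], rule exI[of _ 500000], intro conjI allI impI)
  fix \<epsilon> \<epsilon>' :: real and I S R
  assume eps: "0 < \<epsilon>" "1 / \<epsilon> \<in> \<int>" and eps': "0 < \<epsilon>'" "\<epsilon>' \<le> 1 / 24576 * \<epsilon>"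
    and "valid_instance I" "A_run I \<epsilon> S R"
  then interpret rejection_run I \<epsilon> S R by unfold_locales
  have k: "ennreal (500000 / \<epsilon>\<^sup>2) \<noteq> 0" "ennreal (500000 / \<epsilon>\<^sup>2) \<noteq> top"
    using eps by (auto simp: ennreal_eq_0_iff not_le)
  have speed: "1 \<le> 1 + \<epsilon>'" "1 + \<epsilon>' - 1 \<le> \<epsilon> / 24576" using eps' by auto
  show "A_frac_flow_time I S R \<le> ennreal (500000 / \<epsilon>\<^sup>2) * opt_frac_flow_time I (1 + \<epsilon>')"
    unfolding opt_frac_flow_time_def
    by (intro ennreal_le_mult_INF k flow_times_le_offline(1) speed) simp
  show "ennreal (B_flow_time I \<epsilon> S R) \<le> ennreal (500000 / \<epsilon>\<^sup>2) * opt_frac_flow_time I (1 + \<epsilon>')"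
    unfolding opt_frac_flow_time_def
    by (intro ennreal_le_mult_INF k flow_times_le_offline(2) speed) simp
qed simp_all

end
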